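(* Let $F(x)\in\mathbb{Z}_{\geq 0}[x]$ be a polynomial with $\deg F\geq 1$ and $F(0)=1$, and let $(x_n)_{n\geq 0}$ be the sequence generated from the initial values $x_0=x_1=1$ by the recurrence $$x_{n+2}\,x_n = x_{n+1}^2\,F(x_{n+1}),\qquad n\geq 0.$$ Then the infinite sum $$S_\infty=\sum_{j=1}^\infty \frac{1}{x_j}$$ is a transcendental number.
   Context: $\mathbb{Z}_{\geq 0}[x]$ denotes the set of polynomials with non-negative integer coefficients. Since $F(x)>0$ for $x>0$, all $x_n$ are positive and the recurrence is well defined. The series defining $S_\infty$ converges. Transcendental means not algebraic over $\mathbb{Q}$. *)

theory Defs
  imports Complex_Main "HOL-Computational_Algebra.Polynomial"
begin

end

theory Submission
  imports Defs "Jordan_Normal_Form.Determinant"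
begin

text \<open>Mahler's method. Write \<open>u = 1 / x n\<close>, \<open>v = x n / x (n + 1)\<close> and \<open>T\<close> for the tail
  \<open>\<Sum>j>n. 1 / x j\<close>. One step of the recurrence is the map \<open>(u, v) \<mapsto> (u v, v (u v) ^ d / G_rev (u v))\<close>,
  where \<open>G_rev\<close> is the reciprocal polynomial of \<open>F\<close>, and it sends \<open>T\<close> to \<open>T - u v\<close>; in particular \<open>T\<close> has
  an asymptotic expansion to any order in the monomials \<open>u ^ i v ^ j\<close> with rational coefficients.
  If the sum \<open>\<alpha>\<close> were algebraic, one could choose by linear algebra a nonzero integer polynomial of degree
  less than \<open>p\<close> in each of \<open>u\<close>, \<open>v\<close>, \<open>T\<close> whose values are \<open>O(u ^ N)\<close> with \<open>N\<close> of order \<open>p powr (3/2)\<close>.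
  As \<open>T = \<alpha> - S n\<close>, where \<open>S n\<close> is rational with denominator \<open>x n\<close>, these values are polynomials in \<open>\<alpha>\<close> whose
  coefficients have a denominator that is a power of \<open>x n\<close> with exponent \<open>O(p)\<close>, so a value which does not
  vanish is at least \<open>u ^ (K p)\<close> up to a constant. For large \<open>p\<close> all values vanish eventually.

  This is impossible. The ratio \<open>ln (x (n + 1)) / ln (x n)\<close> tends to an irrational number, hence distinct monomials
  in \<open>u\<close>, \<open>v\<close> have different orders of growth and a nonzero polynomial in \<open>u\<close>, \<open>v\<close> vanishes only finitely often.
  A polynomial relation of minimal degree \<open>m\<close> for \<open>T\<close> must be proportional to its shift;
  the coefficient of degree \<open>m - 1\<close> then exhibits \<open>m \<alpha>\<close>, up to a rational summand, as the limit of a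
  rational function of \<open>u\<close>, \<open>v\<close> over the rationals. Such a limit is rational, but \<open>\<alpha>\<close> is not.\<close>

section \<open>Homogeneous linear systems\<close>

text \<open>Gaussian elimination, one equation at a time: a nontrivial equation is solved for one
  unknown \<open>i0\<close>. This removes one equation and one unknown, so the strict inequality of
  cardinalities survives.\<close>

lemma homogeneous_system_solution:
  fixes c :: "'j \<Rightarrow> 'i \<Rightarrow> 'f::field"
  assumes "finite J" "finite I" "card J < card I"
  shows "\<exists>a. (\<exists>i\<in>I. a i \<noteq> 0) \<and> (\<forall>j\<in>J. (\<Sum>i\<in>I. a i * c j i) = 0)"
  using assms
proof (induction J arbitrary: I c rule: finite_induct)
  case empty
  then have "I \<noteq> {}" by auto
  then show ?case by (intro exI[of _ "\<lambda>_. 1"]) auto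
next
  case (insert j J)
  show ?case
  proof (cases "\<forall>i\<in>I. c j i = 0")
    case True
    have "card J < card I" using insert by simp
    from insert.IH[OF insert.prems(1) this, of c] obtain a
      where "\<exists>i\<in>I. a i \<noteq> 0" "\<forall>j\<in>J. (\<Sum>i\<in>I. a i * c j i) = 0" by blast
    then show ?thesis using True by (intro exI[of _ a]) auto
  next
    case False
    then obtain i0 where i0: "i0 \<in> I" "c j i0 \<noteq> 0" by blast
    define I' where "I' = I - {i0}"
    define c' where "c' k i = c k i - c k i0 * c j i / c j i0" for k i
    have I: "I = insert i0 I'" "i0 \<notin> I'" "finite I'" 
      using i0 insert.prems by (auto simp: I'_def)
    have "card J < card I'" using insert.prems insert.hyps I by simp
    from insert.IH[OF I(3) this, of c'] obtain a
      where a: "\<exists>i\<in>I'. a i \<noteq> 0" "\<forall>j\<in>J. (\<Sum>i\<in>I'. a i * c' j i) = 0" by blast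
    \<comment> \<open>The value at \<open>i0\<close> is forced by equation \<open>j\<close>. With
      it, every equation \<open>k\<close> for \<open>b\<close> turns into the reduced equation
      \<open>c' k\<close> for \<open>a\<close>.\<close>
    define b where "b = a(i0 := - (\<Sum>i\<in>I'. a i * c j i) / c j i0)"
    have sum_b: "(\<Sum>i\<in>I. b i * c k i) = (\<Sum>i\<in>I'. a i * c' k i)" for k
    proof -
      have "(\<Sum>i\<in>I. b i * c k i) = b i0 * c k i0 + (\<Sum>i\<in>I'. b i * c k i)"
        using I by simp
      also have "(\<Sum>i\<in>I'. b i * c k i) = (\<Sum>i\<in>I'. a i * c k i)"
        using I by (intro sum.cong) (auto simp: b_def)
      also have "b i0 * c k i0 = - (\<Sum>i\<in>I'. a i * (c k i0 * c j i / c j i0))"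
      proof -
        have "(\<Sum>i\<in>I'. a i * (c k i0 * c j i / c j i0)) = (\<Sum>i\<in>I'. a i * c j i) * (c k i0 / c j i0)"
          unfolding sum_distrib_right by (intro sum.cong) (simp_all add: mult_ac)
        then show ?thesis by (simp add: b_def)
      qed
      finally show ?thesis 
        by (simp add: c'_def right_diff_distrib sum_subtractf)
    qed
    have "(\<Sum>i\<in>I'. a i * c' j i) = 0"
      using i0 by (intro sum.neutral) (auto simp: c'_def)
    then have "\<forall>k\<in>insert j J. (\<Sum>i\<in>I. b i * c k i) = 0"
      using a sum_b by auto
    moreover have "\<exists>i\<in>I. b i \<noteq> 0" using a I by (auto simp: b_def)
    ultimately show ?thesis by blast
  qed
qed

lemma common_denominator:
  fixes a :: "'i \<Rightarrow> rat"
  assumes "finite I"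
  shows "\<exists>d::int. d > 0 \<and> (\<forall>i\<in>I. \<exists>b::int. a i * of_int d = of_int b)"
  using assms
proof (induction rule: finite_induct)
  case empty
  show ?case by (intro exI[of _ 1]) auto
next
  case (insert j I)
  then obtain d :: int where d: "d > 0" "\<forall>i\<in>I. \<exists>b::int. a i * of_int d = of_int b" by blast
  obtain p q where pq: "quotient_of (a j) = (p, q)" by force
  have q: "q > 0" using quotient_of_denom_pos[OF pq] .
  have "a j * of_int q = of_int p" using quotient_of_div[OF pq] q by simp
  then have 1: "a j * of_int (d * q) = of_int (d * p)" by (simp add: mult.left_commute)
  have 2: "a i * of_int (d * q) = of_int (b * q)" if "a i * of_int d = of_int b" for i b
    using that by (simp flip: mult.assoc)
  have "d * q > 0" using d q by simp
  then show ?case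
    using 1 2 d(2) by (intro exI[of _ "d * q"]) (metis insert_iff)
qed

text \<open>Clearing denominators in a rational solution. The size of the integers is not recorded:
  it enters later only through constants fixed before \<open>n\<close> grows.\<close>

lemma homogeneous_system_solution_int:
  fixes c :: "'j \<Rightarrow> 'i \<Rightarrow> rat"
  assumes "finite J" "finite I" "card J < card I"
  shows "\<exists>a::'i \<Rightarrow> int. (\<exists>i\<in>I. a i \<noteq> 0) \<and> (\<forall>j\<in>J. (\<Sum>i\<in>I. of_int (a i) * c j i) = 0)"
proof -
  obtain a where a: "\<exists>i\<in>I. a i \<noteq> 0" "\<forall>j\<in>J. (\<Sum>i\<in>I. a i * c j i) = 0"
    using homogeneous_system_solution[OF assms] by blast
  obtain d :: int where d: "d > 0" "\<forall>i\<in>I. \<exists>b::int. a i * of_int d = of_int b" 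
    using common_denominator[OF assms(2)] by blast
  then obtain b where b: "\<forall>i\<in>I. a i * of_int d = of_int (b i)" by metis
  have "(\<Sum>i\<in>I. of_int (b i) * c j i) = 0" if "j \<in> J" for j
  proof -
    have "(\<Sum>i\<in>I. of_int (b i) * c j i) = of_int d * (\<Sum>i\<in>I. a i * c j i)"
      unfolding sum_distrib_left using b by (intro sum.cong) (auto simp flip: b simp: mult_ac)
    then show ?thesis using a that by simp
  qed
  moreover from a obtain i where "i \<in> I" "a i \<noteq> 0" by blast
  then have "b i \<noteq> 0" using b d by (metis less_irrefl mult_eq_0_iff of_int_0 of_int_eq_0_iff)
  ultimately show ?thesis using \<open>i \<in> I\<close> by blast
qed

section \<open>A Liouville inequality for polynomials in an algebraic number\<close>

text \<open>Each term of the Leibniz expansion has exactly one factor from column 0 and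
  \<open>n\<close> factors from the other columns. Column 0 is singled out because it will carry the
  small factor \<open>\<beta>\<close>.\<close>

lemma abs_det_le_special_column:
  fixes B :: "real mat"
  assumes B: "B \<in> carrier_mat (Suc n) (Suc n)"
    and s: "\<And>i. i \<le> n \<Longrightarrow> \<bar>B $$ (i, 0)\<bar> \<le> s"
    and t: "\<And>i j. i \<le> n \<Longrightarrow> 0 < j \<Longrightarrow> j \<le> n \<Longrightarrow> \<bar>B $$ (i, j)\<bar> \<le> t"
  shows "\<bar>det B\<bar> \<le> fact (Suc n) * (s * t ^ n)"
proof -
  \<comment> \<open>After transposition the permutation acts on row indices, so the factor with
    index 0 is the one from column 0.\<close>
  have "det B = det (transpose_mat B)" using det_transpose[OF B] by simp
  also have "\<dots> = (\<Sum>p | p permutes {0..<Suc n}. signof p * (\<Prod>i = 0..<Suc n. transpose_mat B $$ (i, p i)))"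
    using B by (intro det_def') auto
  also have "\<bar>\<dots>\<bar> \<le> (\<Sum>p | p permutes {0..<Suc n}. s * t ^ n)"
  proof (rule order.trans[OF sum_abs sum_mono])
    fix p assume "p \<in> {p. p permutes {0..<Suc n}}"
    then have p: "p permutes {0..<Suc n}" by simp
    have p_le: "p i \<le> n" if "i \<le> n" for i
      using permutes_in_image[OF p, of i] that by simp
    have eq: "transpose_mat B $$ (i, p i) = B $$ (p i, i)" if "i \<le> n" for i
      using that p_le[OF that] B by auto
    have "\<bar>signof p * (\<Prod>i = 0..<Suc n. transpose_mat B $$ (i, p i))\<bar> 
        = (\<Prod>i = 0..<Suc n. \<bar>transpose_mat B $$ (i, p i)\<bar>)"
      by (simp add: abs_mult sign_def abs_prod)
    also have "\<dots> = (\<Prod>i = 0..<Suc n. \<bar>B $$ (p i, i)\<bar>)"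
      by (intro prod.cong) (auto simp: eq)
    also have "\<dots> = \<bar>B $$ (p 0, 0)\<bar> * (\<Prod>i = 1..<Suc n. \<bar>B $$ (p i, i)\<bar>)"
      by (subst prod.atLeast_Suc_lessThan) auto
    also have "\<dots> \<le> s * (\<Prod>i = 1..<Suc n. t)"
      using p_le s t
      by (intro mult_mono prod_mono) (auto intro!: prod_nonneg mult_nonneg_nonneg intro: order.trans[OF abs_ge_zero s])
    finally show "\<bar>signof p * (\<Prod>i = 0..<Suc n. transpose_mat B $$ (i, p i))\<bar> \<le> s * t ^ n" by simp
  qed
  also have "\<dots> = fact (Suc n) * (s * t ^ n)" 
    by (subst sum_constant, subst card_permutations[of _ "Suc n"]) (auto simp: algebra_simps)
  finally show ?thesis .
qed

text \<open>The number \<open>\<beta>\<close> below is an eigenvalue of an integer matrix with the eigenvector of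
  powers of \<open>\<alpha>\<close>; its determinant is a nonzero integer, and Cramer's rule exhibits a factor \<open>\<beta>\<close>.\<close>

lemma algebraic_polynomial_value_lower_bound:
  fixes \<alpha> :: real
  assumes "algebraic \<alpha>"
  shows "\<exists>D. \<forall>p. \<exists>c>0. \<forall>H\<ge>1. \<forall>b::nat \<Rightarrow> int. (\<forall>i<p. \<bar>of_int (b i)\<bar> \<le> H) \<longrightarrow>
    (\<Sum>i<p. of_int (b i) * \<alpha> ^ i) \<noteq> 0 \<longrightarrow> c \<le> \<bar>\<Sum>i<p. of_int (b i) * \<alpha> ^ i\<bar> * H ^ D"
proof -
  define Z where "Z n \<longleftrightarrow> (\<exists>f::nat \<Rightarrow> int. f n \<noteq> 0 \<and> (\<Sum>i\<le>n. of_int (f i) * \<alpha> ^ i) = 0)" for n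
  obtain f0 :: "int poly" where f0: "f0 \<noteq> 0" "poly (map_poly of_int f0) \<alpha> = 0"
    using assms by (metis algebraicE')
  have "Z (degree f0)" unfolding Z_def
    by (intro exI[of _ "coeff f0"]) (use f0 in \<open>auto simp: poly_altdef degree_map_poly coeff_map_poly\<close>)
  then have Zl: "Z (LEAST n. Z n)" by (rule LeastI)
  have "\<not> Z 0" by (auto simp: Z_def)
  \<comment> \<open>\<open>Suc D\<close> is the degree of \<alpha>: the powers up to
    \<open>D\<close> are linearly independent over the integers, and the next one depends on
    them.\<close>
  then obtain D where D: "(LEAST n. Z n) = Suc D" using Zl by (cases "LEAST n. Z n") auto
  obtain f :: "nat \<Rightarrow> int" where f: "f (Suc D) \<noteq> 0" "(\<Sum>i\<le>Suc D. of_int (f i) * \<alpha> ^ i) = 0"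
    using Zl D Z_def by metis
  have indep: "v i = 0" if v: "(\<Sum>i\<le>D. of_int (v i) * \<alpha> ^ i) = 0" and "i \<le> D" for v :: "nat \<Rightarrow> int" and i
  proof (rule ccontr)
    assume "v i \<noteq> 0"
    define S where "S = {i. i \<le> D \<and> v i \<noteq> 0}"
    have "finite S" "S \<noteq> {}" using \<open>v i \<noteq> 0\<close> \<open>i \<le> D\<close> by (auto simp: S_def)
    define M where "M = Max S"
    have M: "M \<in> S" unfolding M_def by (rule Max_in) fact+
    have Mmax: "v j = 0" if "M < j" "j \<le> D" for j
      using Max_ge[OF \<open>finite S\<close>, of j] that unfolding M_def[symmetric] by (auto simp: S_def)
    have "(\<Sum>i\<le>M. of_int (v i) * \<alpha> ^ i) = (\<Sum>i\<le>D. of_int (v i) * \<alpha> ^ i)"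
      using M Mmax by (intro sum.mono_neutral_left) (auto simp: S_def)
    then have "Z M" using v M by (auto simp: Z_def S_def)
    then have "Suc D \<le> M" using D by (metis Least_le)
    then show False using M by (simp add: S_def)
  qed
  define a where "a = f (Suc D)"
  have a_pow: "of_int a * \<alpha> ^ Suc D = - (\<Sum>j\<le>D. of_int (f j) * \<alpha> ^ j)"
    using f(2) by (simp add: a_def)
  \<comment> \<open>Multiplication by \<open>a * \<alpha>\<close> preserves integer combinations of
    the powers up to \<open>D\<close>: the coefficients move up by one index, and the overflow is
    rewritten by the minimal relation.\<close>
  have "\<exists>m::nat \<Rightarrow> int. of_int (a ^ k) * \<alpha> ^ k = (\<Sum>j\<le>D. of_int (m j) * \<alpha> ^ j)" for k
  proof (induction k)
    case 0
    show ?case by (intro exI[of _ "\<lambda>j. if j = 0 then 1 else 0"]) (simp add: if_distrib[of of_int] if_distrib[of "\<lambda>z. z * _"] cong: if_cong)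
  next
    case (Suc k)
    then obtain m :: "nat \<Rightarrow> int" where m: "of_int (a ^ k) * \<alpha> ^ k = (\<Sum>j\<le>D. of_int (m j) * \<alpha> ^ j)" by blast
    define m' where "m' j = (if j = 0 then 0 else a * m (j - 1)) - m D * f j" for j
    have "of_int (a ^ Suc k) * \<alpha> ^ Suc k = of_int a * \<alpha> * (\<Sum>j\<le>D. of_int (m j) * \<alpha> ^ j)"
      by (simp flip: m)
    also have "\<dots> = (\<Sum>j\<le>D. of_int (a * m j) * \<alpha> ^ Suc j)"
      by (simp add: sum_distrib_left mult_ac)
    also have "\<dots> = (\<Sum>j<D. of_int (a * m j) * \<alpha> ^ Suc j) + of_int (m D) * (of_int a * \<alpha> ^ Suc D)"
      by (simp add: lessThan_Suc_atMost[symmetric] mult_ac)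
    also have "(\<Sum>j<D. of_int (a * m j) * \<alpha> ^ Suc j) = (\<Sum>j\<le>D. of_int (if j = 0 then 0 else a * m (j - 1)) * \<alpha> ^ j)"
      by (simp add: lessThan_Suc_atMost[symmetric] sum.lessThan_Suc_shift del: sum.lessThan_Suc)
    also have "\<dots> + of_int (m D) * (of_int a * \<alpha> ^ Suc D) = (\<Sum>j\<le>D. of_int (m' j) * \<alpha> ^ j)"
      unfolding a_pow m'_def of_int_diff left_diff_distrib sum_subtractf
      by (simp add: sum_distrib_left mult_ac)
    finally show ?case by blast
  qed
  then obtain m :: "nat \<Rightarrow> nat \<Rightarrow> int" 
    where m: "\<And>k. of_int (a ^ k) * \<alpha> ^ k = (\<Sum>j\<le>D. of_int (m k j) * \<alpha> ^ j)" by metis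
  have "\<exists>c>0. \<forall>H\<ge>1. \<forall>b::nat \<Rightarrow> int. (\<forall>i<p. \<bar>of_int (b i)\<bar> \<le> H) \<longrightarrow>
    (\<Sum>i<p. of_int (b i) * \<alpha> ^ i) \<noteq> 0 \<longrightarrow> c \<le> \<bar>\<Sum>i<p. of_int (b i) * \<alpha> ^ i\<bar> * H ^ D" for p
  proof -
    \<comment> \<open>\<open>P\<close> exceeds every exponent \<open>l + i\<close> that occurs, so
      the single power \<open>a ^ P\<close> clears all denominators; \<open>g i j l\<close> is then
      the coordinate of \<open>a ^ P * \<alpha> ^ (l + i)\<close> at
      \<open>\<alpha> ^ j\<close>.\<close>
    define P where "P = p + D"
    define g where "g i j l = a ^ (P - (l + i)) * m (l + i) j" for i j l
    define K where "K = 1 + (\<Sum>i\<le>D. \<Sum>j\<le>D. \<Sum>l<p. \<bar>real_of_int (g i j l)\<bar>)"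
    define L where "L = 1 + (\<Sum>i\<le>D. \<bar>\<alpha>\<bar> ^ i)"
    define A where "A = \<bar>real_of_int a\<bar> ^ P"
    define G where "G = fact (Suc D) * (A * L * K ^ D)"
    have "K > 0" unfolding K_def by (intro add_pos_nonneg sum_nonneg) auto
    have "L > 0" unfolding L_def by (intro add_pos_nonneg sum_nonneg) auto
    have "A > 0" using f by (simp add: A_def a_def)
    have "G > 0" using \<open>K > 0\<close> \<open>L > 0\<close> \<open>A > 0\<close> by (simp add: G_def)
    have K: "(\<Sum>l<p. \<bar>real_of_int (g i j l)\<bar>) \<le> K" if "i \<le> D" "j \<le> D" for i j
    proof -
      have "(\<Sum>l<p. \<bar>real_of_int (g i j l)\<bar>) \<le> (\<Sum>j\<le>D. \<Sum>l<p. \<bar>real_of_int (g i j l)\<bar>)"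
        using that by (intro member_le_sum[where f = "\<lambda>j. \<Sum>l<p. \<bar>real_of_int (g i j l)\<bar>"]) (auto intro: sum_nonneg)
      also have "\<dots> \<le> (\<Sum>i\<le>D. \<Sum>j\<le>D. \<Sum>l<p. \<bar>real_of_int (g i j l)\<bar>)"
        using that by (intro member_le_sum[where f = "\<lambda>i. \<Sum>j\<le>D. \<Sum>l<p. \<bar>real_of_int (g i j l)\<bar>"]) (auto intro!: sum_nonneg)
      finally show ?thesis by (simp add: K_def)
    qed
    have L: "\<bar>\<alpha>\<bar> ^ i \<le> L" if "i \<le> D" for i
    proof -
      have "\<bar>\<alpha>\<bar> ^ i \<le> (\<Sum>i\<le>D. \<bar>\<alpha>\<bar> ^ i)"
        using that by (intro member_le_sum) auto
      then show ?thesis by (simp add: L_def)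
    qed
    have "1 / G \<le> \<bar>\<beta>\<bar> * H ^ D"
      if H: "H \<ge> 1" and b: "\<forall>i<p. \<bar>of_int (b i)\<bar> \<le> H" 
        and \<beta>: "\<beta> = (\<Sum>i<p. of_int (b i) * \<alpha> ^ i)" and nz: "\<beta> \<noteq> 0" for H \<beta> and b :: "nat \<Rightarrow> int"
    proof -
      \<comment> \<open>Row \<open>i\<close> holds the coordinates of
        \<open>a ^ P * \<beta> * \<alpha> ^ i\<close> in the powers of \<alpha>; the eigenvalue is
        thus \<open>a ^ P * \<beta>\<close>.\<close>
      define M where "M = mat (Suc D) (Suc D) (\<lambda>(i, j). \<Sum>l<p. b l * g i j l)"
      define R where "R = map_mat real_of_int M"
      define w where "w = vec (Suc D) (\<lambda>i. \<alpha> ^ i)"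
      have M: "M \<in> carrier_mat (Suc D) (Suc D)" by (simp add: M_def)
      have R: "R \<in> carrier_mat (Suc D) (Suc D)" by (simp add: R_def M)
      have w: "w \<in> carrier_vec (Suc D)" by (simp add: w_def)
      have R_ij: "R $$ (i, j) = (\<Sum>l<p. of_int (b l) * of_int (g i j l))" if "i \<le> D" "j \<le> D" for i j
        using that by (simp add: R_def M_def)
      have eig: "(\<Sum>j\<le>D. (\<Sum>l<p. of_int (b l) * of_int (g i j l)) * \<alpha> ^ j) = of_int a ^ P * \<beta> * \<alpha> ^ i"
        if "i \<le> D" for i
      proof -
        have "(\<Sum>j\<le>D. (\<Sum>l<p. of_int (b l) * of_int (g i j l)) * \<alpha> ^ j) =
          (\<Sum>l<p. of_int (b l) * of_int a ^ (P - (l + i)) * (\<Sum>j\<le>D. of_int (m (l + i) j) * \<alpha> ^ j))"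
          unfolding sum_distrib_left sum_distrib_right
          by (subst sum.swap) (simp add: g_def mult_ac)
        also have "\<dots> = (\<Sum>l<p. of_int (b l) * of_int a ^ P * \<alpha> ^ (l + i))"
        proof (rule sum.cong)
          fix l assume "l \<in> {..<p}"
          then have "l + i \<le> P" using that by (simp add: P_def)
          then have "real_of_int a ^ P = of_int a ^ (P - (l + i)) * of_int a ^ (l + i)"
            by (simp flip: power_add)
          then show "of_int (b l) * of_int a ^ (P - (l + i)) * (\<Sum>j\<le>D. of_int (m (l + i) j) * \<alpha> ^ j)
            = of_int (b l) * of_int a ^ P * \<alpha> ^ (l + i)"
            by (simp flip: m)
        qed simp
        also have "\<dots> = of_int a ^ P * \<beta> * \<alpha> ^ i"
          by (simp add: \<beta> sum_distrib_left sum_distrib_right power_add mult_ac)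
        finally show ?thesis .
      qed
      have Rw: "R *\<^sub>v w = vec (Suc D) (\<lambda>i. of_int a ^ P * \<beta> * \<alpha> ^ i)"
      proof (rule eq_vecI)
        fix i assume "i < dim_vec (vec (Suc D) (\<lambda>i. of_int a ^ P * \<beta> * \<alpha> ^ i))"
        then have i: "i \<le> D" by simp
        have "(R *\<^sub>v w) $ i = (\<Sum>j\<le>D. R $$ (i, j) * \<alpha> ^ j)"
          using i R by (simp add: scalar_prod_def w_def lessThan_Suc_atMost[symmetric] atLeast0LessThan)
        also have "\<dots> = of_int a ^ P * \<beta> * \<alpha> ^ i"
          using eig[OF i] i by (simp add: R_ij)
        finally show "(R *\<^sub>v w) $ i = vec (Suc D) (\<lambda>i. of_int a ^ P * \<beta> * \<alpha> ^ i) $ i"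
          using i by simp
      qed (use R in auto)
      \<comment> \<open>A vector in the left kernel would, after cancelling
        \<open>a ^ P * \<beta>\<close>, give a nontrivial integer relation among the powers up to
        \<open>D\<close>.\<close>
      have "det M \<noteq> 0"
      proof
        assume "det M = 0"
        then have "det (transpose_mat M) = 0" using det_transpose[OF M] by simp
        moreover have MT: "transpose_mat M \<in> carrier_mat (Suc D) (Suc D)" using M by simp
        ultimately obtain v where v: "v \<in> carrier_vec (Suc D)" "v \<noteq> 0\<^sub>v (Suc D)"
          "transpose_mat M *\<^sub>v v = 0\<^sub>v (Suc D)"
          using det_0_iff_vec_prod_zero[OF MT] by blast
        have col: "(\<Sum>i\<le>D. (\<Sum>l<p. b l * g i j l) * v $ i) = 0" if "j \<le> D" for j
        proof -
          have "(transpose_mat M *\<^sub>v v) $ j = (\<Sum>i\<le>D. M $$ (i, j) * v $ i)"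
            using that M v(1) by (simp add: scalar_prod_def lessThan_Suc_atMost[symmetric] atLeast0LessThan)
          moreover have "(transpose_mat M *\<^sub>v v) $ j = 0" unfolding v(3) using that by simp
          moreover have "(\<Sum>i\<le>D. M $$ (i, j) * v $ i) = (\<Sum>i\<le>D. (\<Sum>l<p. b l * g i j l) * v $ i)"
            using that by (intro sum.cong) (auto simp: M_def)
          ultimately show ?thesis by metis
        qed
        have "of_int a ^ P * \<beta> * (\<Sum>i\<le>D. of_int (v $ i) * \<alpha> ^ i) 
          = (\<Sum>i\<le>D. of_int (v $ i) * (of_int a ^ P * \<beta> * \<alpha> ^ i))"
          by (simp add: sum_distrib_left mult_ac)
        also have "\<dots> = (\<Sum>i\<le>D. of_int (v $ i) * (\<Sum>j\<le>D. (\<Sum>l<p. of_int (b l) * of_int (g i j l)) * \<alpha> ^ j))"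
          by (simp add: eig)
        also have "\<dots> = (\<Sum>j\<le>D. of_int (\<Sum>i\<le>D. (\<Sum>l<p. b l * g i j l) * v $ i) * \<alpha> ^ j)"
          unfolding sum_distrib_left of_int_sum sum_distrib_right
          by (subst sum.swap) (simp add: sum_distrib_left sum_distrib_right mult_ac)
        also have "\<dots> = 0" by (simp add: col)
        finally have "(\<Sum>i\<le>D. of_int (v $ i) * \<alpha> ^ i) = 0" using nz f by (simp add: a_def)
        then have "v $ i = 0" if "i \<le> D" for i using indep that by blast
        then have "v = 0\<^sub>v (Suc D)" using v(1) by (intro eq_vecI) auto
        then show False using v by simp
      qed
      moreover have "det R = of_int (det M)" by (simp add: R_def of_int_hom.hom_det)
      ultimately have "1 \<le> \<bar>det R\<bar>" by simp
      \<comment> \<open>The entry of \<open>w\<close> at 0 is 1, so Cramer's rule returns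
        \<open>det R\<close> itself, while the new column 0 is divisible by
        \<open>\<beta>\<close>.\<close>
      also have "det R = det (replace_col R (R *\<^sub>v w) 0)"
        using cramer_lemma_mat[OF R w, of 0] by (simp add: w_def)
      also have "\<bar>\<dots>\<bar> \<le> fact (Suc D) * (A * \<bar>\<beta>\<bar> * L * (H * K) ^ D)"
      proof (rule abs_det_le_special_column)
        show "replace_col R (R *\<^sub>v w) 0 \<in> carrier_mat (Suc D) (Suc D)" using R by (simp add: replace_col_def)
      next
        fix i assume "i \<le> D"
        then show "\<bar>replace_col R (R *\<^sub>v w) 0 $$ (i, 0)\<bar> \<le> A * \<bar>\<beta>\<bar> * L"
          using R L[of i] \<open>A > 0\<close> 
          by (simp add: replace_col_def Rw abs_mult power_abs A_def mult_left_mono del: index_mult_mat_vec)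
      next
        fix i j assume ij: "i \<le> D" "0 < j" "j \<le> D"
        then have "replace_col R (R *\<^sub>v w) 0 $$ (i, j) = (\<Sum>l<p. of_int (b l) * of_int (g i j l))"
          using R by (simp add: replace_col_def R_ij)
        also have "\<bar>\<dots>\<bar> \<le> (\<Sum>l<p. H * \<bar>of_int (g i j l)\<bar>)"
          by (rule order.trans[OF sum_abs]) (use b in \<open>auto intro!: sum_mono mult_right_mono simp: abs_mult\<close>)
        also have "\<dots> \<le> H * K"
          using K[of i j] ij H by (simp flip: sum_distrib_left)
        finally show "\<bar>replace_col R (R *\<^sub>v w) 0 $$ (i, j)\<bar> \<le> H * K" .
      qed
      also have "\<dots> = G * (\<bar>\<beta>\<bar> * H ^ D)" by (simp add: G_def power_mult_distrib)
      finally show ?thesis using \<open>G > 0\<close> by (simp add: field_simps)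
    qed
    then show ?thesis using \<open>G > 0\<close> by (intro exI[of _ "1 / G"]) auto
  qed
  then show ?thesis by blast
qed

section \<open>The sequence and its growth\<close>

locale hone_sequence =
  fixes F :: "int poly" and x :: "nat \<Rightarrow> real"
  assumes F_nonneg: "\<And>i. coeff F i \<ge> 0"
    and F_degree: "degree F \<ge> 1"
    and F_at_0: "poly F 0 = 1"
    and x_0: "x 0 = 1"
    and x_1: "x 1 = 1"
    and x_rec: "\<And>n. x (n + 2) * x n = (x (n + 1))\<^sup>2 * poly (map_poly real_of_int F) (x (n + 1))"
begin

abbreviation d :: nat where "d \<equiv> degree F"

definition G :: "real \<Rightarrow> real" where "G t = poly (map_poly real_of_int F) t"

definition G_rev :: "real \<Rightarrow> real" where "G_rev t = (\<Sum>i\<le>d. of_int (coeff F i) * t ^ (d - i))"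

definition u :: "nat \<Rightarrow> real" where "u n = 1 / x n"

definition v :: "nat \<Rightarrow> real" where "v n = x n / x (Suc n)"

definition \<alpha> :: real where "\<alpha> = (\<Sum>j. 1 / x (j + 1))"

definition S :: "nat \<Rightarrow> real" where "S n = (\<Sum>j<n. u (Suc j))"

definition T :: "nat \<Rightarrow> real" where "T n = \<alpha> - S n"

section \<open>Bounds for the polynomial and its reciprocal\<close>

lemma G_altdef: "G t = (\<Sum>i\<le>d. of_int (coeff F i) * t ^ i)"
  by (simp add: G_def poly_altdef degree_map_poly coeff_map_poly)

lemma coeff_0 [simp]: "coeff F 0 = 1"
  using F_at_0 by (simp add: poly_0_coeff_0)

lemma lead_coeff_ge_1: "coeff F d \<ge> 1"
proof -
  have "F \<noteq> 0" using F_degree by auto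
  then have "coeff F d \<noteq> 0" by simp
  then show ?thesis using F_nonneg[of d] by linarith
qed

lemma G_ge: "t \<ge> 1 \<Longrightarrow> G t \<ge> 1 + t"
proof -
  assume t: "t \<ge> 1"
  have "1 + t \<le> of_int (coeff F 0) * t ^ 0 + of_int (coeff F d) * t ^ d"
  proof -
    have "t \<le> t ^ d" using F_degree t self_le_power by fastforce
    also have "\<dots> \<le> of_int (coeff F d) * t ^ d"
      using lead_coeff_ge_1 t by (simp add: mult_le_cancel_right1)
    finally show ?thesis by simp
  qed
  also have "\<dots> = (\<Sum>i\<in>{0, d}. of_int (coeff F i) * t ^ i)"
    using F_degree by (subst sum.insert) auto
  also have "\<dots> \<le> G t"
    unfolding G_altdef using F_nonneg t by (intro sum_mono2) auto
  finally show ?thesis .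
qed

lemma G_Ints: "t \<in> \<int> \<Longrightarrow> G t \<in> \<int>"
  unfolding G_altdef by (intro Ints_sum Ints_mult Ints_power) auto

lemma G_eq_rev: "t \<noteq> 0 \<Longrightarrow> G t = t ^ d * G_rev (1 / t)"
  unfolding G_altdef G_rev_def sum_distrib_left
  by (intro sum.cong) (auto simp: power_divide power_diff)

lemma G_rev_ge_1: "t \<ge> 0 \<Longrightarrow> G_rev t \<ge> 1"
proof -
  assume t: "t \<ge> 0"
  have "1 \<le> of_int (coeff F d) * t ^ (d - d)" using lead_coeff_ge_1 by simp
  also have "\<dots> \<le> G_rev t" unfolding G_rev_def
    using F_nonneg t by (intro member_le_sum) auto
  finally show ?thesis .
qed

lemma G_rev_le: "0 \<le> t \<Longrightarrow> t \<le> 1 \<Longrightarrow> G_rev t \<le> G 1"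
  unfolding G_rev_def G_altdef using F_nonneg
  by (intro sum_mono mult_left_mono) (auto intro: power_le_one)

text \<open>The four claims need each other: the ratio \<open>w = x (n + 1) / x n\<close> is
  multiplied by \<open>G (x (n + 1))\<close> in each step, so it stays integral as long as the terms
  do, and its size in turn controls the terms.\<close>

lemma x_facts: "x n \<ge> 1 \<and> x n \<in> \<int> \<and> x (Suc n) / x n \<in> \<int> \<and> x (Suc n) / x n \<ge> x n"
proof (induction n)
  case 0
  show ?case using x_0 x_1 by simp
next
  case (Suc n)
  define w where "w = x (Suc n) / x n"
  have w: "w \<in> \<int>" "w \<ge> x n" "x n \<ge> 1" "x n \<in> \<int>" using Suc by (auto simp: w_def)
  have xS: "x (Suc n) = w * x n" using w by (simp add: w_def)
  have 1: "x (Suc n) \<ge> 1" "x (Suc n) \<in> \<int>"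
    unfolding xS using w mult_mono[of 1 w 1 "x n"] by auto
  have "x (Suc (Suc n)) * x n = (x (Suc n))\<^sup>2 * G (x (Suc n))"
    using x_rec[of n] by (simp add: G_def)
  then have 2: "x (Suc (Suc n)) / x (Suc n) = w * G (x (Suc n))"
    using 1 w unfolding w_def by (simp add: field_simps power2_eq_square)
  have "1 * x (Suc n) \<le> w * G (x (Suc n))"
    using G_ge[OF 1(1)] 1 w by (intro mult_mono) auto
  then show ?case using 1 2 w G_Ints by auto
qed

lemma x_ge_1: "x n \<ge> 1" and x_Ints: "x n \<in> \<int>" 
  and x_ratio_Ints: "x (Suc n) / x n \<in> \<int>" and x_ratio_ge: "x (Suc n) / x n \<ge> x n"
  using x_facts by auto

lemma x_pos [simp]: "x n > 0" and x_nonzero [simp]: "x n \<noteq> 0"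
  using x_ge_1[of n] by auto

section \<open>The variables \<open>u\<close> and \<open>v\<close> along the orbit\<close>

lemma u_pos [simp]: "u n > 0" and v_pos [simp]: "v n > 0"
  by (simp_all add: u_def v_def)

lemma u_nonneg [simp]: "u n \<ge> 0" and v_nonneg [simp]: "v n \<ge> 0"
  by (simp_all add: order_less_imp_le)

lemma u_nz [simp]: "u n \<noteq> 0" and v_nz [simp]: "v n \<noteq> 0"
  using u_pos[of n] v_pos[of n] by linarith+

lemma u_le_1 [simp]: "u n \<le> 1"
  using x_ge_1[of n] by (simp add: u_def)

lemma v_le_u: "v n \<le> u n"
proof -
  have "v n = 1 / (x (Suc n) / x n)" by (simp add: v_def)
  also have "\<dots> \<le> 1 / x n" using x_ratio_ge[of n] by (intro divide_left_mono) auto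
  finally show ?thesis by (simp add: u_def)
qed

lemma v_le_1 [simp]: "v n \<le> 1"
  using v_le_u[of n] u_le_1[of n] by linarith

lemma u_Suc: "u (Suc n) = u n * v n"
  by (simp add: u_def v_def)

lemma x_rec': "x (Suc (Suc n)) * x n = (x (Suc n))\<^sup>2 * G (x (Suc n))"
  using x_rec[of n] by (simp add: G_def)

lemma G_x: "G (x n) = x n ^ d * G_rev (u n)"
  by (simp add: G_eq_rev u_def)

lemma v_Suc: "v (Suc n) = v n * u (Suc n) ^ d * (1 / G_rev (u (Suc n)))"
proof -
  have nz: "G_rev (u (Suc n)) > 0" using G_rev_ge_1[of "u (Suc n)"] by simp
  have "x (Suc (Suc n)) * x n = x (Suc n) ^ 2 * (x (Suc n) ^ d * G_rev (u (Suc n)))"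
    using x_rec'[of n] by (simp add: G_x)
  then have "x (Suc (Suc n)) = x (Suc n) ^ 2 * (x (Suc n) ^ d * G_rev (u (Suc n))) / x n"
    by (simp add: field_simps)
  then show ?thesis using nz
    by (simp add: v_def u_def[of "Suc n"] field_simps power2_eq_square)
qed

lemma u_antimono: "u (n + k) \<le> u n"
proof (induction k)
  case (Suc k)
  have "u (n + Suc k) = u (n + k) * v (n + k)" by (simp add: u_Suc)
  also have "\<dots> \<le> u (n + k) * 1" by (intro mult_left_mono) auto
  finally show ?case using Suc by simp
qed simp

lemma u_power: "u (n + k) \<le> u n ^ Suc k"
proof (induction k)
  case (Suc k)
  have "u (n + Suc k) = u (n + k) * v (n + k)" by (simp add: u_Suc)
  also have "\<dots> \<le> u n ^ Suc k * u n"
    using Suc v_le_u[of "n + k"] u_antimono[of n k] by (intro mult_mono) auto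
  finally show ?case by (simp add: mult_ac)
qed simp

text \<open>The index starts at 1 because \<open>v 0 = 1\<close>. From there on the polynomial
  contributes a factor of at least 2, which gives geometric decay of \<open>u\<close>.\<close>

lemma v_Suc_le_half: "v (Suc n) \<le> 1 / 2"
proof -
  have "x (Suc (Suc n)) * x n = x (Suc n) * x (Suc n) * G (x (Suc n))"
    using x_rec'[of n] by (simp add: power2_eq_square)
  also have "\<dots> \<ge> x (Suc n) * x n * 2"
  proof -
    have "1 \<le> x (Suc n) / x n" using x_ratio_ge[of n] x_ge_1[of n] by linarith
    then have "x n \<le> x (Suc n)" by (simp add: le_divide_eq)
    then show ?thesis using G_ge[of "x (Suc n)"] x_ge_1[of "Suc n"] 
      by (intro mult_mono) (auto simp: less_imp_le)
  qed
  finally have "x (Suc n) * 2 \<le> x (Suc (Suc n))" by (simp add: mult_ac)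
  then show ?thesis by (simp add: v_def field_simps)
qed

lemma u_geometric: "u (Suc n + k) \<le> u (Suc n) * (1 / 2) ^ k"
proof (induction k)
  case (Suc k)
  have "u (Suc n + Suc k) = u (Suc n + k) * v (Suc n + k)" by (simp add: u_Suc)
  also have "\<dots> \<le> (u (Suc n) * (1 / 2) ^ k) * (1 / 2)"
    using Suc v_Suc_le_half[of "n + k"] by (intro mult_mono) auto
  finally show ?case by simp
qed simp

section \<open>Summability, tails and partial sums\<close>

lemma summable_u: "summable (\<lambda>j. u (Suc n + j))"
  by (rule summable_comparison_test'[where g = "\<lambda>k. u (Suc n) * (1 / 2) ^ k" and N = 0])
     (use u_geometric in \<open>auto intro!: summable_mult\<close>)

lemma summable_inverse_x: "summable (\<lambda>j. 1 / x (j + 1))"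
  using summable_u[of 0] by (simp add: u_def)

lemma T_suminf: "T n = (\<Sum>j. u (Suc n + j))"
proof -
  have s: "summable (\<lambda>j. u (Suc j))" using summable_u[of 0] by simp
  have "\<alpha> = (\<Sum>j. u (Suc j))" by (simp add: \<alpha>_def u_def)
  also have "\<dots> = (\<Sum>j. u (Suc (j + n))) + S n"
    using suminf_split_initial_segment[OF s, of n] by (simp add: S_def)
  finally show ?thesis by (simp add: T_def add_ac)
qed

lemma T_pos: "T n > 0"
  unfolding T_suminf using summable_u by (intro suminf_pos) auto

lemma T_le: "T n \<le> 2 * u (Suc n)"
proof -
  have "T n \<le> (\<Sum>k. u (Suc n) * (1 / 2) ^ k)"
    unfolding T_suminf using u_geometric summable_u
    by (intro suminf_le) (auto intro!: summable_mult)
  also have "\<dots> = 2 * u (Suc n)" 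
    by (subst suminf_mult) (auto simp: suminf_geometric)
  finally show ?thesis .
qed

lemma S_Suc: "S (Suc n) = S n + u (Suc n)"
  by (simp add: S_def)

lemma T_Suc: "T (Suc n) = T n - u (Suc n)"
  by (simp add: T_def S_Suc)

lemma u_tendsto_0: "u \<longlonglongrightarrow> 0"
proof -
  have "(\<lambda>j. u (Suc j)) \<longlonglongrightarrow> 0"
    using summable_LIMSEQ_zero[OF summable_u[of 0]] by simp
  then show ?thesis by (simp add: filterlim_sequentially_Suc)
qed

lemma v_tendsto_0: "v \<longlonglongrightarrow> 0"
  by (rule tendsto_sandwich[OF _ _ tendsto_const u_tendsto_0]) (auto simp: v_le_u)

lemma T_tendsto_0: "T \<longlonglongrightarrow> 0"
proof (rule tendsto_sandwich[OF _ _ tendsto_const])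
  show "(\<lambda>n. 2 * u (Suc n)) \<longlonglongrightarrow> 0"
    using tendsto_mult[OF tendsto_const, of "\<lambda>n. u (Suc n)" 0 _ 2] u_tendsto_0
    by (simp add: filterlim_sequentially_Suc)
qed (use T_pos T_le in \<open>auto intro!: always_eventually less_imp_le\<close>)

lemma S_tendsto: "S \<longlonglongrightarrow> \<alpha>"
proof -
  have "(\<lambda>n. \<alpha> - T n) \<longlonglongrightarrow> \<alpha> - 0" by (intro tendsto_intros T_tendsto_0)
  then show ?thesis by (simp add: T_def)
qed

text \<open>Follows from the recurrence by discarding the factor \<open>x m\<close>, which is at
  least 1. It serves to bound the denominators \<open>x n * x (Suc n)\<close> by powers of
  \<open>x n\<close> alone.\<close>

lemma x_Suc_le: "x (Suc n) \<le> G 1 * x n ^ (d + 2)"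
proof (cases n)
  case 0
  then show ?thesis using x_0 x_1 G_ge[of 1] by simp
next
  case (Suc m)
  have "x (Suc n) * 1 \<le> x (Suc (Suc m)) * x m"
    unfolding Suc using x_ge_1[of m] by (intro mult_left_mono) (auto simp: less_imp_le)
  also have "\<dots> = x n ^ 2 * (x n ^ d * G_rev (u n))"
    using x_rec'[of m] by (simp add: G_x Suc)
  also have "\<dots> \<le> x n ^ 2 * (x n ^ d * G 1)"
    by (intro mult_left_mono G_rev_le) (auto simp: less_imp_le)
  finally show ?thesis by (simp add: power_add power2_eq_square mult_ac)
qed

text \<open>Each term of the sequence divides the next one, so the last term is a common denominator
  of the partial sum.\<close>

lemma S_x_Ints: "S n * x n \<in> \<int>"
proof (induction n)
  case (Suc n)
  have "S (Suc n) * x (Suc n) = (S n * x n) * (x (Suc n) / x n) + 1"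
    by (simp add: S_Suc u_def field_simps)
  then show ?case using Suc x_ratio_Ints[of n] by (metis Ints_1 Ints_add Ints_mult)
qed (simp add: S_def)

text \<open>If \<alpha> had denominator \<open>b\<close>, then \<open>b * T n * x n\<close> would be
  a positive integer; but it is at most \<open>2 * b * v n\<close>, which tends to 0.\<close>

lemma \<alpha>_irrational: "\<alpha> \<notin> \<rat>"
proof
  assume "\<alpha> \<in> \<rat>"
  then obtain a b :: int where ab: "b > 0" "\<alpha> = of_int a / of_int b"
    by (meson Rats_cases')
  have "2 * of_int b * v n \<ge> 1" for n
  proof -
    have "of_int b * T n * x n = of_int a * x n - of_int b * (S n * x n)"
      using ab by (simp add: T_def algebra_simps)
    then have "of_int b * T n * x n \<in> \<int>"
      using S_x_Ints[of n] x_Ints[of n] by simp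
    moreover have "of_int b * T n * x n > 0" using ab T_pos[of n] by simp
    ultimately have "1 \<le> of_int b * T n * x n" by (auto elim!: Ints_cases)
    also have "\<dots> \<le> of_int b * (2 * u (Suc n)) * x n"
      using T_le[of n] ab by (intro mult_left_mono mult_right_mono) (auto simp: less_imp_le)
    also have "\<dots> = 2 * of_int b * v n" by (simp add: u_def v_def)
    finally show ?thesis .
  qed
  moreover have "(\<lambda>n. 2 * of_int b * v n) \<longlonglongrightarrow> 2 * of_int b * 0"
    by (intro tendsto_intros v_tendsto_0)
  ultimately have "1 \<le> 2 * real_of_int b * 0"
    by (intro LIMSEQ_le_const) auto
  then show False by simp
qed

text \<open>The larger root of \<open>t ^ 2 - (d + 2) * t + 1\<close>, the characteristic polynomial
  of the linear recurrence that the logarithms satisfy up to a bounded error.\<close>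

definition \<rho> :: real where "\<rho> = (real d + 2 + sqrt (real d * (real d + 4))) / 2"

lemma \<rho>_ge_2: "\<rho> \<ge> 2"
proof -
  define s where "s = sqrt (real d * (real d + 4))"
  have d: "real d \<ge> 1" using F_degree by simp
  then have "real d * (real d + 4) \<ge> 1 * 1" by (intro mult_mono) auto
  then have "s \<ge> 1" unfolding s_def using real_le_rsqrt[of 1] by simp
  then show ?thesis using d unfolding \<rho>_def s_def[symmetric] by simp
qed

lemma \<rho>_root: "\<rho> * \<rho> + 1 = (real d + 2) * \<rho>"
proof -
  define s where "s = sqrt (real d * (real d + 4))"
  have "s * s = real d * (real d + 4)" by (simp add: s_def)
  then show ?thesis unfolding \<rho>_def s_def[symmetric] by (simp add: field_simps)
qed

text \<open>A root \<open>m / n\<close> in lowest terms gives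
  \<open>m * m + n * n = (d + 2) * m * n\<close>. Hence \<open>m\<close> divides
  \<open>n * n\<close> and \<open>n\<close> divides \<open>m * m\<close>, so both are 1, against
  \<open>\<rho>_ge_2\<close>.\<close>

lemma \<rho>_irrational: "\<rho> \<notin> \<rat>"
proof
  assume "\<rho> \<in> \<rat>"
  then obtain m n :: nat where mn: "n \<noteq> 0" "\<bar>\<rho>\<bar> = real m / real n" "coprime m n"
    by (rule Rats_abs_nat_div_natE)
  then have l: "\<rho> * real n = real m" using \<rho>_ge_2 by simp
  have "real m * real m + real n * real n = (\<rho> * \<rho> + 1) * real n * real n"
    by (simp flip: l add: algebra_simps)
  also have "\<dots> = (real d + 2) * real m * real n"
    unfolding \<rho>_root by (simp flip: l add: algebra_simps)
  finally have "real (m * m + n * n) = real ((d + 2) * m * n)"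
    by (simp only: of_nat_add of_nat_mult of_nat_numeral)
  then have eq: "m * m + n * n = (d + 2) * m * n" by (simp only: of_nat_eq_iff)
  have "m dvd m * m + n * n" "n dvd m * m + n * n" unfolding eq by simp_all
  then have "m dvd n * n" "n dvd m * m" by (auto simp: dvd_add_right_iff dvd_add_left_iff)
  then have "is_unit m" "is_unit n"
    using mn(3) by (meson coprime_mult_right_iff coprime_commute dvd_refl coprime_common_divisor)+
  then show False using l \<rho>_ge_2 by simp
qed

section \<open>Growth of the logarithms\<close>

lemma x_2_ge: "x 2 \<ge> 2"
proof -
  have "x 2 = G 1" using x_rec'[of 0] x_0 x_1 by (simp add: numeral_2_eq_2)
  then show ?thesis using G_ge[of 1] by simp
qed

lemma x_square_le: "x n ^ 2 \<le> x (Suc n)"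
  using x_ratio_ge[of n] by (simp add: le_divide_eq power2_eq_square)

lemma ln_x_ge: "ln (x (2 + k)) \<ge> 2 ^ k * ln 2"
proof (induction k)
  case 0
  show ?case using x_2_ge by simp
next
  case (Suc k)
  have "2 ^ Suc k * ln 2 \<le> 2 * ln (x (2 + k))" using Suc by simp
  also have "\<dots> = ln (x (2 + k) ^ 2)" by (simp add: ln_realpow)
  also have "\<dots> \<le> ln (x (2 + Suc k))" 
    using x_square_le[of "2 + k"] by (intro ln_mono) auto
  finally show ?case .
qed

lemma ln_x_pos: "n \<ge> 2 \<Longrightarrow> ln (x n) > 0"
proof -
  assume "n \<ge> 2"
  then obtain k where "n = 2 + k" using le_Suc_ex by blast
  have "0 < 2 ^ k * ln (2::real)" by simp
  then show ?thesis unfolding \<open>n = 2 + k\<close> using ln_x_ge[of k] by linarith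
qed

lemma ln_x_at_top: "filterlim (\<lambda>n. ln (x n)) at_top sequentially"
proof -
  have "filterlim (\<lambda>n. ln (1 / u n)) at_top sequentially"
    by (rule filterlim_compose[OF ln_at_top])
       (auto simp: filterlim_inverse_at_top_iff eventually_sequentially u_tendsto_0 simp flip: inverse_eq_divide)
  then show ?thesis by (simp add: u_def)
qed

text \<open>The logarithms satisfy \<open>L (n + 2) = (d + 2) L (n + 1) - L n + O(1)\<close>, so the errors
  \<open>\<bar>r n - \<rho>\<bar>\<close> of the ratios \<open>r n = L (n + 1) / L n\<close> contract by a factor 4, up to a perturbation
  that decays like \<open>2 ^ - n\<close>.\<close>

lemma ln_x_ratio_tendsto: "(\<lambda>n. ln (x (Suc n)) / ln (x n)) \<longlonglongrightarrow> \<rho>"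
proof -
  define L where "L n = ln (x n)" for n
  define r where "r n = L (Suc n) / L n" for n
  define g where "g n = ln (G_rev (u (Suc n))) / L (Suc n)" for n
  have r_rec: "r (Suc n) = real d + 2 + g n - 1 / r n" if "n \<ge> 2" for n
  proof -
    have L: "L n > 0" "L (Suc n) > 0" unfolding L_def using that by (intro ln_x_pos; simp)+
    have Gp: "G_rev (u (Suc n)) > 0" using G_rev_ge_1[of "u (Suc n)"] by simp
    have "ln (x (Suc (Suc n)) * x n) = ln (x (Suc n) ^ (d + 2) * G_rev (u (Suc n)))"
      unfolding x_rec' by (simp add: G_x power_add power2_eq_square mult_ac)
    then have "L (Suc (Suc n)) = (real d + 2) * L (Suc n) + ln (G_rev (u (Suc n))) - L n"
      using Gp by (simp add: ln_mult ln_realpow L_def distrib_right)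
    then show ?thesis using L by (simp add: r_def g_def add_divide_distrib diff_divide_distrib)
  qed
  have r_ge: "r n \<ge> 2" if "n \<ge> 2" for n
  proof -
    have "2 * L n = ln (x n ^ 2)" by (simp add: ln_realpow L_def)
    also have "\<dots> \<le> L (Suc n)" unfolding L_def using x_square_le[of n] by (intro ln_mono) auto
    finally show ?thesis using ln_x_pos[OF that] by (simp add: r_def L_def le_divide_eq)
  qed
  define C where "C = ln (G 1) / ln 2"
  have C: "C \<ge> 0" using G_ge[of 1] by (simp add: C_def)
  have g_le: "\<bar>g (2 + k)\<bar> \<le> C * (1 / 2) ^ k" for k
  proof -
    have G1: "1 \<le> G_rev (u (Suc (2 + k)))" "G_rev (u (Suc (2 + k))) \<le> G 1"
      using G_rev_ge_1 G_rev_le by auto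
    have "2 ^ k * ln (2::real) \<le> 2 ^ Suc k * ln 2" by simp
    also have "\<dots> \<le> L (Suc (2 + k))" using ln_x_ge[of "Suc k"] by (simp add: L_def)
    finally have L: "2 ^ k * ln 2 \<le> L (Suc (2 + k))" .
    have "\<bar>g (2 + k)\<bar> = ln (G_rev (u (Suc (2 + k)))) / L (Suc (2 + k))"
      using G1 L ln_x_pos[of "Suc (2 + k)"] by (simp add: g_def L_def)
    also have "\<dots> \<le> ln (G 1) / (2 ^ k * ln 2)"
      using G1 L by (intro frac_le) auto
    finally show ?thesis by (simp add: C_def power_one_over mult.commute)
  qed
  \<comment> \<open>Besides the base case, this choice makes the perturbation at most
    \<open>K / 4\<close>; the contraction leaves another \<open>K / 4\<close>, and together they
    give the \<open>K / 2\<close> wanted at the next index.\<close>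
  define K where "K = max \<bar>r 2 - \<rho>\<bar> (4 * C)"
  have "\<bar>r (2 + k) - \<rho>\<bar> \<le> K * (1 / 2) ^ k" for k
  proof (induction k)
    case 0
    show ?case by (simp add: K_def)
  next
    case (Suc k)
    define n where "n = 2 + k"
    have rn: "r n \<ge> 2" using r_ge by (simp add: n_def)
    have "\<rho> = real d + 2 - 1 / \<rho>" using \<rho>_root \<rho>_ge_2 by (simp add: field_simps)
    then have "r (Suc n) - \<rho> = g n + (1 / \<rho> - 1 / r n)" using r_rec[of n] by (simp add: n_def)
    also have "1 / \<rho> - 1 / r n = (r n - \<rho>) / (\<rho> * r n)" using rn \<rho>_ge_2 by (simp add: field_simps)
    finally have "\<bar>r (Suc n) - \<rho>\<bar> \<le> \<bar>g n\<bar> + \<bar>(r n - \<rho>) / (\<rho> * r n)\<bar>" 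
      by (metis abs_triangle_ineq)
    also have "\<bar>(r n - \<rho>) / (\<rho> * r n)\<bar> = \<bar>r n - \<rho>\<bar> / (\<rho> * r n)"
      using rn \<rho>_ge_2 by (simp add: abs_mult)
    also have "\<dots> \<le> \<bar>r n - \<rho>\<bar> / (2 * 2)"
      using rn \<rho>_ge_2 by (intro divide_left_mono mult_mono) auto
    also have "\<dots> \<le> K * (1 / 2) ^ k / 4" using Suc by (simp add: n_def)
    also have "\<bar>g n\<bar> \<le> K / 4 * (1 / 2) ^ k"
    proof -
      have "\<bar>g n\<bar> \<le> C * (1 / 2) ^ k" using g_le[of k] by (simp add: n_def)
      also have "\<dots> \<le> K / 4 * (1 / 2) ^ k" by (intro mult_right_mono) (auto simp: K_def)
      finally show ?thesis .
    qed
    finally show ?case by (simp add: n_def)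
  qed
  then have le: "\<forall>\<^sub>F k in sequentially. \<bar>r (2 + k) - \<rho>\<bar> \<le> K * (1 / 2) ^ k" by simp
  have "(\<lambda>k. K * (1 / 2) ^ k) \<longlonglongrightarrow> K * 0"
    by (intro tendsto_intros LIMSEQ_power_zero) auto
  then have lim: "(\<lambda>k. K * (1 / 2) ^ k) \<longlonglongrightarrow> 0" by simp
  have "(\<lambda>k. \<bar>r (2 + k) - \<rho>\<bar>) \<longlonglongrightarrow> 0"
    by (rule tendsto_sandwich[OF _ le tendsto_const lim]) simp
  then have "(\<lambda>k. r (2 + k) - \<rho>) \<longlonglongrightarrow> 0" by (rule tendsto_rabs_zero_cancel)
  then have "(\<lambda>k. r (k + 2)) \<longlonglongrightarrow> \<rho>" by (simp add: LIM_zero_iff add.commute)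
  then have "r \<longlonglongrightarrow> \<rho>" by (rule LIMSEQ_offset)
  then show ?thesis by (simp add: r_def[abs_def] L_def)
qed

section \<open>Polynomials in \<open>u\<close> and \<open>v\<close> along the orbit\<close>

definition uv_monom :: "nat \<times> nat \<Rightarrow> nat \<Rightarrow> real" where "uv_monom p n = u n ^ fst p * v n ^ snd p"

text \<open>The order of a monomial measured in powers of \<open>u\<close>:
  \<open>ln (v n) / ln (u n)\<close> tends to \<open>\<rho> - 1\<close>, hence
  \<open>ln (uv_monom p n) / ln (u n)\<close> tends to \<open>weight p\<close>.\<close>

definition weight :: "nat \<times> nat \<Rightarrow> real" where "weight p = real (fst p) + real (snd p) * (\<rho> - 1)"

lemma uv_monom_pos [simp]: "uv_monom p n > 0"
  by (simp add: uv_monom_def)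

lemma uv_monom_nonzero [simp]: "uv_monom p n \<noteq> 0"
  using uv_monom_pos[of p n] by linarith

text \<open>Equal weights with different second exponents would express \<open>\<rho>\<close> as a
  rational number.\<close>

lemma weight_inj: "weight p = weight q \<Longrightarrow> p = q"
proof -
  assume eq: "weight p = weight q"
  have "snd p = snd q"
  proof (rule ccontr)
    assume ne: "snd p \<noteq> snd q"
    have "(real (snd p) - real (snd q)) * (\<rho> - 1) = real (fst q) - real (fst p)"
      using eq by (simp add: weight_def algebra_simps)
    then have "\<rho> = (real (fst q) - real (fst p)) / (real (snd p) - real (snd q)) + 1"
      using ne by (simp add: field_simps)
    also have "\<dots> \<in> \<rat>" by (intro Rats_add Rats_divide Rats_diff) auto
    finally show False using \<rho>_irrational by blast
  qed
  then show ?thesis using eq by (simp add: weight_def prod_eq_iff)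
qed

text \<open>The quotient is the exponential of \<open>- ln (x n)\<close> times a factor that tends
  to \<open>weight p - weight q\<close>.\<close>

lemma uv_monom_quotient_tendsto_0:
  assumes "weight p > weight q"
  shows "(\<lambda>n. uv_monom p n / uv_monom q n) \<longlonglongrightarrow> 0"
proof -
  define a where "a = real (fst p) - real (fst q)"
  define b where "b = real (snd p) - real (snd q)"
  have w: "a + b * (\<rho> - 1) > 0" using assms by (simp add: weight_def a_def b_def algebra_simps)
  have "filterlim (\<lambda>n. (a + b * (ln (x (Suc n)) / ln (x n) - 1)) * ln (x n)) at_top sequentially"
    by (rule filterlim_tendsto_pos_mult_at_top[OF _ w ln_x_at_top]) 
       (intro tendsto_intros ln_x_ratio_tendsto)
  then have "filterlim (\<lambda>n. - ((a + b * (ln (x (Suc n)) / ln (x n) - 1)) * ln (x n))) at_bot sequentially"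
    by (simp add: filterlim_uminus_at_top)
  then have lim: "(\<lambda>n. exp (- ((a + b * (ln (x (Suc n)) / ln (x n) - 1)) * ln (x n)))) \<longlonglongrightarrow> 0"
    by (rule filterlim_compose[OF exp_at_bot])
  have "\<forall>\<^sub>F n in sequentially. exp (- ((a + b * (ln (x (Suc n)) / ln (x n) - 1)) * ln (x n))) = uv_monom p n / uv_monom q n"
    using eventually_ge_at_top[of 2]
  proof eventually_elim
    case (elim n)
    have "ln (x n) > 0" using ln_x_pos[OF elim] .
    then have "- ((a + b * (ln (x (Suc n)) / ln (x n) - 1)) * ln (x n)) = a * ln (u n) + b * ln (v n)"
      by (simp add: u_def v_def ln_div field_simps)
    also have "\<dots> = ln (uv_monom p n / uv_monom q n)"
      by (simp add: uv_monom_def ln_div ln_mult ln_realpow a_def b_def algebra_simps)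
    finally show ?case by simp
  qed
  then show ?thesis using lim by (rule Lim_transform_eventually[rotated])
qed

text \<open>The polynomials in \<open>u\<close> and \<open>v\<close> over the rationals, taken as
  sequences of values along the orbit. The inductive form suits closure arguments;
  \<open>uv_polys_rep\<close> recovers explicit coefficients.\<close>

inductive_set uv_polys :: "(nat \<Rightarrow> real) set" where
  const: "(\<lambda>_. of_rat c) \<in> uv_polys"
| u: "u \<in> uv_polys"
| v: "v \<in> uv_polys"
| add: "s \<in> uv_polys \<Longrightarrow> t \<in> uv_polys \<Longrightarrow> (\<lambda>n. s n + t n) \<in> uv_polys"
| mult: "s \<in> uv_polys \<Longrightarrow> t \<in> uv_polys \<Longrightarrow> (\<lambda>n. s n * t n) \<in> uv_polys"

section \<open>Closure properties, leading monomials and limits\<close>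

lemma uv_polys_of_int: "(\<lambda>_. of_int c) \<in> uv_polys"
  using uv_polys.const[of "of_int c"] by simp

lemma uv_polys_of_nat: "(\<lambda>_. of_nat c) \<in> uv_polys"
  using uv_polys.const[of "of_nat c"] by simp

lemma uv_polys_uminus: "s \<in> uv_polys \<Longrightarrow> (\<lambda>n. - s n) \<in> uv_polys"
  using uv_polys.mult[OF uv_polys_of_int[of "-1"], of s] by simp

lemma uv_polys_diff: "s \<in> uv_polys \<Longrightarrow> t \<in> uv_polys \<Longrightarrow> (\<lambda>n. s n - t n) \<in> uv_polys"
  using uv_polys.add[OF _ uv_polys_uminus, of s t] by simp

lemma uv_polys_power: "s \<in> uv_polys \<Longrightarrow> (\<lambda>n. s n ^ k) \<in> uv_polys"
proof (induction k)
  case 0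
  show ?case using uv_polys_of_int[of 1] by simp
next
  case (Suc k)
  then show ?case using uv_polys.mult[of s "\<lambda>n. s n ^ k"] by simp
qed

lemma uv_polys_sum: "(\<And>i. i \<in> I \<Longrightarrow> s i \<in> uv_polys) \<Longrightarrow> (\<lambda>n. \<Sum>i\<in>I. s i n) \<in> uv_polys"
proof (induction I rule: infinite_finite_induct)
  case (insert j I)
  then show ?case using uv_polys.add[of "s j" "\<lambda>n. \<Sum>i\<in>I. s i n"] by simp
qed (use uv_polys_of_int[of 0] in auto)

lemmas uv_polys_intros = uv_polys.intros uv_polys_of_int uv_polys_of_nat uv_polys_uminus 
  uv_polys_diff uv_polys_power uv_polys_sum

lemma uv_polys_rep:
  "s \<in> uv_polys \<Longrightarrow> \<exists>I c. finite I \<and> s = (\<lambda>n. \<Sum>p\<in>I. of_rat (c p) * uv_monom p n)"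
proof (induction rule: uv_polys.induct)
  case (const c)
  show ?case by (intro exI[of _ "{(0, 0)}"] exI[of _ "\<lambda>_. c"]) (auto simp: uv_monom_def)
next
  case u
  show ?case by (intro exI[of _ "{(1, 0)}"] exI[of _ "\<lambda>_. 1"]) (auto simp: uv_monom_def)
next
  case v
  show ?case by (intro exI[of _ "{(0, 1)}"] exI[of _ "\<lambda>_. 1"]) (auto simp: uv_monom_def)
next
  case (add s t)
  then obtain I J :: "(nat \<times> nat) set" and b c :: "nat \<times> nat \<Rightarrow> rat" where IJ: "finite I" "finite J"
    "s = (\<lambda>n. \<Sum>p\<in>I. of_rat (b p) * uv_monom p n)" "t = (\<lambda>n. \<Sum>p\<in>J. of_rat (c p) * uv_monom p n)"
    by blast
  define e where "e p = (if p \<in> I then b p else 0) + (if p \<in> J then c p else 0)" for p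
  have "s n + t n = (\<Sum>p\<in>I \<union> J. of_rat (e p) * uv_monom p n)" for n
  proof -
    have "s n = (\<Sum>p\<in>I \<union> J. of_rat (if p \<in> I then b p else 0) * uv_monom p n)"
      unfolding IJ using IJ by (intro sum.mono_neutral_cong_left) auto
    moreover have "t n = (\<Sum>p\<in>I \<union> J. of_rat (if p \<in> J then c p else 0) * uv_monom p n)"
      unfolding IJ using IJ by (intro sum.mono_neutral_cong_left) auto
    ultimately show ?thesis unfolding e_def of_rat_add distrib_right sum.distrib by simp
  qed
  then show ?case using IJ by blast
next
  case (mult s t)
  then obtain I J :: "(nat \<times> nat) set" and b c :: "nat \<times> nat \<Rightarrow> rat" where IJ: "finite I" "finite J"
    "s = (\<lambda>n. \<Sum>p\<in>I. of_rat (b p) * uv_monom p n)" "t = (\<lambda>n. \<Sum>p\<in>J. of_rat (c p) * uv_monom p n)"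
    by blast
  define f where "f z = (fst (fst z) + fst (snd z), snd (fst z) + snd (snd z))" for z :: "(nat \<times> nat) \<times> nat \<times> nat"
  define e where "e r = (\<Sum>z\<in>{z \<in> I \<times> J. f z = r}. b (fst z) * c (snd z))" for r
  have fin: "finite (I \<times> J)" using IJ by simp
  have "s n * t n = (\<Sum>r\<in>f ` (I \<times> J). of_rat (e r) * uv_monom r n)" for n
  proof -
    have "s n * t n = (\<Sum>z\<in>I \<times> J. of_rat (b (fst z) * c (snd z)) * uv_monom (f z) n)"
      unfolding IJ sum_product sum.cartesian_product
      by (intro sum.cong) (auto simp: of_rat_mult uv_monom_def f_def power_add)
    also have "\<dots> = (\<Sum>r\<in>f ` (I \<times> J). \<Sum>z\<in>{z \<in> I \<times> J. f z = r}. of_rat (b (fst z) * c (snd z)) * uv_monom (f z) n)"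
      by (rule sum.image_gen[OF fin])
    also have "\<dots> = (\<Sum>r\<in>f ` (I \<times> J). of_rat (e r) * uv_monom r n)"
      unfolding e_def of_rat_sum sum_distrib_right by (intro sum.cong) auto
    finally show ?thesis .
  qed
  then show ?case using fin by blast
qed

text \<open>By injectivity of the weight, exactly one monomial of the support has least weight, and
  it dominates all the others.\<close>

lemma uv_sum_asymptotics:
  assumes I: "finite I" and nz: "\<exists>p\<in>I. c p \<noteq> 0"
  obtains p where "p \<in> I" "c p \<noteq> 0" 
    "(\<lambda>n. (\<Sum>q\<in>I. of_rat (c q) * uv_monom q n) / uv_monom p n) \<longlonglongrightarrow> of_rat (c p)"
proof -
  define I0 where "I0 = {p \<in> I. c p \<noteq> 0}"
  have I0: "finite I0" "I0 \<noteq> {}" using I nz by (auto simp: I0_def)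
  have s0: "(\<Sum>q\<in>I. of_rat (c q) * uv_monom q n) = (\<Sum>p\<in>I0. of_rat (c p) * uv_monom p n)" for n
    using I by (intro sum.mono_neutral_right) (auto simp: I0_def)
  obtain p where p: "p \<in> I0" "\<And>q. q \<in> I0 \<Longrightarrow> weight p \<le> weight q"
    using I0 by (metis arg_min_if_finite(1) arg_min_least)
  have "(\<lambda>n. \<Sum>q\<in>I0. of_rat (c q) * (uv_monom q n / uv_monom p n)) 
      \<longlonglongrightarrow> (\<Sum>q\<in>I0. of_rat (c q) * (if q = p then 1 else 0))"
  proof (intro tendsto_sum tendsto_mult tendsto_const)
    fix q assume "q \<in> I0"
    then show "(\<lambda>n. uv_monom q n / uv_monom p n) \<longlonglongrightarrow> (if q = p then 1 else 0)"
      using p(2)[of q] weight_inj[of p q] uv_monom_quotient_tendsto_0[where p = q and q = p] 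
      by (cases "p = q") force+
  qed
  moreover have "(\<Sum>q\<in>I0. of_rat (c q) * (if q = p then 1 else 0)) = (of_rat (c p) :: real)"
    using p(1) I0 by (simp add: if_distrib[of "\<lambda>z. _ * z"] cong: if_cong)
  moreover have "(\<Sum>q\<in>I0. of_rat (c q) * (uv_monom q n / uv_monom p n)) 
      = (\<Sum>q\<in>I. of_rat (c q) * uv_monom q n) / uv_monom p n" for n
    by (simp add: s0 sum_divide_distrib)
  ultimately have "(\<lambda>n. (\<Sum>q\<in>I. of_rat (c q) * uv_monom q n) / uv_monom p n) \<longlonglongrightarrow> of_rat (c p)" 
    by simp
  moreover have "p \<in> I" "c p \<noteq> 0" using p(1) by (auto simp: I0_def)
  ultimately show thesis using that by blast
qed

lemma uv_monoms_independent:
  assumes "finite I" "\<And>n. (\<Sum>q\<in>I. of_rat (c q) * uv_monom q n) = 0" "p \<in> I"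
  shows "c p = 0"
proof (rule ccontr)
  assume "c p \<noteq> 0"
  with assms obtain q where "c q \<noteq> 0" 
    "(\<lambda>n. (\<Sum>q\<in>I. of_rat (c q) * uv_monom q n) / uv_monom q n) \<longlonglongrightarrow> of_rat (c q)"
    using uv_sum_asymptotics[of I c] by blast
  then show False using assms(2) by (simp add: LIMSEQ_const_iff)
qed

lemma uv_polys_asymptotics:
  assumes "s \<in> uv_polys" "s \<noteq> (\<lambda>_. 0)"
  obtains p c where "c \<noteq> 0" "(\<lambda>n. s n / uv_monom p n) \<longlonglongrightarrow> of_rat c"
proof -
  obtain I c where I: "finite I" and s: "s = (\<lambda>n. \<Sum>p\<in>I. of_rat (c p) * uv_monom p n)"
    using uv_polys_rep[OF assms(1)] by blast
  have "\<exists>p\<in>I. c p \<noteq> 0"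
  proof (rule ccontr)
    assume "\<not> (\<exists>p\<in>I. c p \<noteq> 0)"
    then have "s = (\<lambda>_. 0)" unfolding s by (intro ext sum.neutral) auto
    then show False using assms(2) by blast
  qed
  from uv_sum_asymptotics[OF I this] show thesis using that s by blast
qed

lemma uv_polys_eventually_nonzero:
  assumes "s \<in> uv_polys" "s \<noteq> (\<lambda>_. 0)"
  shows "\<forall>\<^sub>F n in sequentially. s n \<noteq> 0"
proof -
  obtain p c where pc: "c \<noteq> 0" "(\<lambda>n. s n / uv_monom p n) \<longlonglongrightarrow> of_rat c"
    using uv_polys_asymptotics[OF assms] .
  then have "\<forall>\<^sub>F n in sequentially. s n / uv_monom p n \<noteq> 0"
    by (intro tendsto_imp_eventually_ne) auto
  then show ?thesis by eventually_elim auto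
qed

text \<open>Numerator and denominator are compared with their leading monomials. If these agree, the
  limit is the quotient of two rational coefficients; otherwise the quotient tends to 0 or cannot
  converge.\<close>

lemma uv_polys_quotient_limit_rational:
  assumes s: "s \<in> uv_polys" and t: "t \<in> uv_polys" "t \<noteq> (\<lambda>_. 0)"
    and lim: "(\<lambda>n. s n / t n) \<longlonglongrightarrow> l"
  shows "l \<in> \<rat>"
proof (cases "s = (\<lambda>_. 0)")
  case True
  then have "(\<lambda>n. 0) \<longlonglongrightarrow> l" using lim by simp
  then have "l = 0" by (simp add: LIMSEQ_const_iff)
  then show ?thesis by simp
next
  case False
  obtain p b where pb: "b \<noteq> 0" "(\<lambda>n. s n / uv_monom p n) \<longlonglongrightarrow> of_rat b"
    using uv_polys_asymptotics[OF s False] .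
  obtain q c where qc: "c \<noteq> 0" "(\<lambda>n. t n / uv_monom q n) \<longlonglongrightarrow> of_rat c"
    using uv_polys_asymptotics[OF t] .
  have quot: "(\<lambda>n. (s n / uv_monom p n) / (t n / uv_monom q n)) \<longlonglongrightarrow> of_rat b / of_rat c"
    using pb qc by (intro tendsto_divide) auto
  consider "weight q < weight p" | "weight p < weight q" | "p = q"
    using weight_inj[of p q] by fastforce
  then show ?thesis
  proof cases
    case 1
    have "(\<lambda>n. (s n / uv_monom p n) / (t n / uv_monom q n) * (uv_monom p n / uv_monom q n)) \<longlonglongrightarrow> of_rat b / of_rat c * 0"
      by (intro tendsto_mult quot uv_monom_quotient_tendsto_0 1)
    then have "(\<lambda>n. s n / t n) \<longlonglongrightarrow> 0" by simp
    then have "l = 0" using lim LIMSEQ_unique by blast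
    then show ?thesis by simp
  next
    case 2
    have "(\<lambda>n. s n / t n * (uv_monom q n / uv_monom p n)) \<longlonglongrightarrow> l * 0"
      by (intro tendsto_mult lim uv_monom_quotient_tendsto_0 2)
    then have "(\<lambda>n. (s n / uv_monom p n) / (t n / uv_monom q n)) \<longlonglongrightarrow> 0" by (simp add: mult_ac)
    then have "of_rat b / of_rat c = (0::real)" using quot LIMSEQ_unique by blast
    then show ?thesis using pb qc by simp
  next
    case 3
    then have "(\<lambda>n. s n / t n) \<longlonglongrightarrow> of_rat b / of_rat c" using quot by simp
    then have "l = of_rat b / of_rat c" using lim LIMSEQ_unique by blast
    then show ?thesis by simp
  qed
qed

section \<open>Rationality of the values and the shift of the index\<close>

lemma u_Rats: "u n \<in> \<rat>" and v_Rats: "v n \<in> \<rat>"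
proof -
  have "x k \<in> \<rat>" for k using x_Ints[of k] Ints_subset_Rats by blast
  then show "u n \<in> \<rat>" "v n \<in> \<rat>" by (auto simp: u_def v_def)
qed

lemma S_Rats: "S n \<in> \<rat>"
  unfolding S_def by (intro Rats_sum u_Rats)

lemma uv_polys_Rats: "s \<in> uv_polys \<Longrightarrow> s n \<in> \<rat>"
  by (induction rule: uv_polys.induct) (auto simp: u_Rats v_Rats)

lemma u_Suc_uv_polys: "(\<lambda>n. u (Suc n)) \<in> uv_polys"
  unfolding u_Suc by (intro uv_polys_intros)

lemma G_rev_uv_polys: "(\<lambda>n. G_rev (u (Suc n))) \<in> uv_polys"
  unfolding G_rev_def u_Suc by (intro uv_polys_intros)

lemma uv_polys_shift:
  "s \<in> uv_polys \<Longrightarrow> \<exists>M. \<forall>M'\<ge>M. (\<lambda>n. G_rev (u (Suc n)) ^ M' * s (Suc n)) \<in> uv_polys"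
proof (induction rule: uv_polys.induct)
  case (const c)
  show ?case by (intro exI[of _ 0] allI impI uv_polys_intros G_rev_uv_polys)
next
  case u
  show ?case by (intro exI[of _ 0] allI impI uv_polys_intros G_rev_uv_polys u_Suc_uv_polys)
next
  case v
  have "(\<lambda>n. G_rev (u (Suc n)) ^ M * v (Suc n)) \<in> uv_polys" if M: "M \<ge> 1" for M
  proof -
    obtain k where M: "M = Suc k" using M by (cases M) auto
    have "G_rev (u (Suc n)) ^ M * v (Suc n) = G_rev (u (Suc n)) ^ k * (v n * u (Suc n) ^ d)" for n
      using G_rev_ge_1[of "u (Suc n)"] by (simp add: M v_Suc)
    then show ?thesis by (simp add: uv_polys_intros G_rev_uv_polys u_Suc_uv_polys)
  qed
  then show ?case by blast
next
  case (add s t)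
  then obtain M1 M2 where "\<forall>M'\<ge>M1. (\<lambda>n. G_rev (u (Suc n)) ^ M' * s (Suc n)) \<in> uv_polys"
    "\<forall>M'\<ge>M2. (\<lambda>n. G_rev (u (Suc n)) ^ M' * t (Suc n)) \<in> uv_polys" by blast
  then have "\<forall>M'\<ge>max M1 M2. (\<lambda>n. G_rev (u (Suc n)) ^ M' * s (Suc n) + G_rev (u (Suc n)) ^ M' * t (Suc n)) \<in> uv_polys"
    by (auto intro: uv_polys.add)
  then show ?case unfolding distrib_left by blast
next
  case (mult s t)
  then obtain M1 M2 where M: "\<forall>M'\<ge>M1. (\<lambda>n. G_rev (u (Suc n)) ^ M' * s (Suc n)) \<in> uv_polys"
    "\<forall>M'\<ge>M2. (\<lambda>n. G_rev (u (Suc n)) ^ M' * t (Suc n)) \<in> uv_polys" by blast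
  have "(\<lambda>n. G_rev (u (Suc n)) ^ M' * (s (Suc n) * t (Suc n))) \<in> uv_polys" if M': "M' \<ge> M1 + M2" for M'
  proof -
    obtain k where k: "M' = M1 + (M2 + k)" using M' le_Suc_ex by (metis add.assoc)
    have "(\<lambda>n. (G_rev (u (Suc n)) ^ M1 * s (Suc n)) * (G_rev (u (Suc n)) ^ (M2 + k) * t (Suc n))) \<in> uv_polys"
      using M by (intro uv_polys.mult[of "\<lambda>n. G_rev (u (Suc n)) ^ M1 * s (Suc n)"]) auto
    then show ?thesis by (simp add: k power_add mult_ac)
  qed
  then show ?case by blast
qed

lemma uv_polys_eventually_zero:
  assumes "s \<in> uv_polys" "\<forall>\<^sub>F n in sequentially. s n = 0"
  shows "s = (\<lambda>_. 0)"
proof (rule ccontr)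
  assume "s \<noteq> (\<lambda>_. 0)"
  from uv_polys_eventually_nonzero[OF assms(1) this] assms(2)
  have "\<forall>\<^sub>F n in sequentially. False" by eventually_elim auto
  then show False by simp
qed

text \<open>Eliminating the top power of \<open>T\<close> between a relation and its shift leaves a
  relation of smaller degree, trivial by induction. The resulting proportionality makes
  \<open>A m n / A (Suc m) n\<close> grow like a multiple of the partial sums, which would force
  \<alpha> to be rational.\<close>

lemma T_transcendental_over_uv_polys:
  assumes "\<And>k. k \<le> m \<Longrightarrow> A k \<in> uv_polys"
    and "\<forall>\<^sub>F n in sequentially. (\<Sum>k\<le>m. A k n * T n ^ k) = 0" and "k \<le> m"
  shows "A k = (\<lambda>_. 0)"
  using assms
proof (induction m arbitrary: A k)
  case 0
  then show ?case using uv_polys_eventually_zero[of "A 0"] by simp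
next
  case (Suc m)
  note A = Suc.prems(1) and rel = Suc.prems(2)
  have top: "A (Suc m) = (\<lambda>_. 0)"
  proof (rule ccontr)
    assume nz: "A (Suc m) \<noteq> (\<lambda>_. 0)"
    let ?\<Gamma> = "\<lambda>n. G_rev (u (Suc n))"
    have "\<forall>i. \<exists>M. i \<le> Suc m \<longrightarrow> (\<forall>M'\<ge>M. (\<lambda>n. ?\<Gamma> n ^ M' * A i (Suc n)) \<in> uv_polys)"
      using uv_polys_shift A by blast
    then obtain Mf where Mf: "\<And>i M'. i \<le> Suc m \<Longrightarrow> Mf i \<le> M' \<Longrightarrow> (\<lambda>n. ?\<Gamma> n ^ M' * A i (Suc n)) \<in> uv_polys"
      by metis
    define M where "M = Max (Mf ` {..Suc m})"
    define B where "B i n = ?\<Gamma> n ^ M * A i (Suc n)" for i n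
    have B: "B i \<in> uv_polys" if "i \<le> Suc m" for i
      unfolding B_def using that by (intro Mf) (auto simp: M_def)
    \<comment> \<open>The coefficients of the shifted relation as a polynomial in
      \<open>T n\<close>, from the binomial expansion of \<open>T n - u n * v n\<close>. Truncation
      in \<open>i - k\<close> is harmless, since \<open>i choose k\<close> vanishes for
      \<open>i < k\<close>.\<close>
    define B' where "B' k n = (\<Sum>i\<le>Suc m. B i n * (of_nat (i choose k) * (- (u n * v n)) ^ (i - k)))" for k n
    have B': "B' k \<in> uv_polys" for k
      unfolding B'_def using B by (intro uv_polys_intros) auto
    have B'_top: "B' (Suc m) n = B (Suc m) n" for n
    proof -
      have "(\<Sum>i\<le>m. B i n * (of_nat (i choose Suc m) * (- (u n * v n)) ^ (i - Suc m))) = 0"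
        by (intro sum.neutral) (auto simp: binomial_eq_0)
      then show ?thesis by (simp add: B'_def)
    qed
    have B'_m: "B' m n = B m n - B (Suc m) n * (real (Suc m) * (u n * v n))" for n
    proof -
      have "(\<Sum>i<m. B i n * (of_nat (i choose m) * (- (u n * v n)) ^ (i - m))) = 0"
        by (intro sum.neutral) (auto simp: binomial_eq_0)
      then have "(\<Sum>i\<le>m. B i n * (of_nat (i choose m) * (- (u n * v n)) ^ (i - m))) = B m n"
        by (simp add: lessThan_Suc_atMost[symmetric])
      then show ?thesis by (simp add: B'_def)
    qed
    have B'_sum: "(\<Sum>k\<le>Suc m. B' k n * T n ^ k) = ?\<Gamma> n ^ M * (\<Sum>i\<le>Suc m. A i (Suc n) * T (Suc n) ^ i)" for n
    proof -
      have bin: "T (Suc n) ^ i = (\<Sum>k\<le>Suc m. of_nat (i choose k) * (- (u n * v n)) ^ (i - k) * T n ^ k)" if "i \<le> Suc m" for i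
      proof -
        have "T (Suc n) ^ i = (T n + - (u n * v n)) ^ i" by (simp add: T_Suc u_Suc)
        also have "\<dots> = (\<Sum>k\<le>i. of_nat (i choose k) * T n ^ k * (- (u n * v n)) ^ (i - k))"
          by (rule binomial_ring)
        also have "\<dots> = (\<Sum>k\<le>Suc m. of_nat (i choose k) * T n ^ k * (- (u n * v n)) ^ (i - k))"
          using that by (intro sum.mono_neutral_left) (auto simp: binomial_eq_0)
        finally show ?thesis by (simp only: mult_ac)
      qed
      have "(\<Sum>k\<le>Suc m. B' k n * T n ^ k) = 
        (\<Sum>i\<le>Suc m. B i n * (\<Sum>k\<le>Suc m. of_nat (i choose k) * (- (u n * v n)) ^ (i - k) * T n ^ k))"
        unfolding B'_def sum_distrib_left sum_distrib_right
        by (subst sum.swap) (simp only: mult_ac)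
      also have "\<dots> = (\<Sum>i\<le>Suc m. B i n * T (Suc n) ^ i)"
        by (intro sum.cong refl) (simp only: bin atMost_iff)
      finally show ?thesis by (simp only: B_def sum_distrib_left mult_ac)
    qed
    \<comment> \<open>Cross-multiplication with the two top coefficients cancels the term of index
      \<open>Suc m\<close>.\<close>
    define C where "C k n = A (Suc m) n * B' k n - B' (Suc m) n * A k n" for k n
    have C: "C k \<in> uv_polys" if "k \<le> m" for k
      unfolding C_def using that A B' by (intro uv_polys_intros) auto
    have relS: "\<forall>\<^sub>F n in sequentially. (\<Sum>k\<le>Suc m. A k (Suc n) * T (Suc n) ^ k) = 0"
      using rel by (subst eventually_sequentially_Suc)
    have "\<forall>\<^sub>F n in sequentially. (\<Sum>k\<le>m. C k n * T n ^ k) = 0"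
      using rel relS
    proof eventually_elim
      case (elim n)
      have "(\<Sum>k\<le>m. C k n * T n ^ k) = (\<Sum>k\<le>Suc m. C k n * T n ^ k)"
        by (simp add: C_def)
      also have "\<dots> = A (Suc m) n * (\<Sum>k\<le>Suc m. B' k n * T n ^ k) - B' (Suc m) n * (\<Sum>k\<le>Suc m. A k n * T n ^ k)"
        unfolding C_def left_diff_distrib sum_subtractf sum_distrib_left by (simp only: mult_ac)
      also have "\<dots> = 0" unfolding B'_sum elim by simp
      finally show ?case .
    qed
    then have "C m = (\<lambda>_. 0)" using C by (intro Suc.IH) auto
    then have Cm: "A (Suc m) n * B' m n = B' (Suc m) n * A m n" for n
      by (metis C_def eq_iff_diff_eq_0)
    \<comment> \<open>\<open>g\<close> grows by \<open>Suc m\<close> times the increment of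
      \<open>S\<close>, so \<open>g - Suc m * S\<close> is constant from \<open>n0\<close> on. This
      constant is rational, as values at \<open>n0\<close> show.\<close>
    define g where "g n = A m n / A (Suc m) n" for n
    have "\<forall>\<^sub>F n in sequentially. A (Suc m) n \<noteq> 0"
      using nz A by (intro uv_polys_eventually_nonzero) auto
    then obtain n0 where n0: "\<And>n. n \<ge> n0 \<Longrightarrow> A (Suc m) n \<noteq> 0"
      by (auto simp: eventually_sequentially)
    have g_Suc: "g (Suc n) = g n + real (Suc m) * u (Suc n)" if "n \<ge> n0" for n
    proof -
      have nzs: "A (Suc m) n \<noteq> 0" "A (Suc m) (Suc n) \<noteq> 0" using n0 that by auto
      have \<Gamma>: "?\<Gamma> n ^ M \<noteq> 0" using G_rev_ge_1[of "u (Suc n)"] by simp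
      have "?\<Gamma> n ^ M * (A (Suc m) n * (A m (Suc n) - A (Suc m) (Suc n) * (real (Suc m) * u (Suc n)))) =
        ?\<Gamma> n ^ M * (A (Suc m) (Suc n) * A m n)"
        using Cm[of n] unfolding B'_m B'_top B_def u_Suc[symmetric] by (simp only: algebra_simps)
      then have "A (Suc m) n * (A m (Suc n) - A (Suc m) (Suc n) * (real (Suc m) * u (Suc n))) =
        A (Suc m) (Suc n) * A m n" by (rule iffD1[OF mult_left_cancel[OF \<Gamma>]])
      then show ?thesis unfolding g_def using nzs by (simp add: divide_simps) (simp add: algebra_simps)
    qed
    define \<kappa> where "\<kappa> = g n0 - real (Suc m) * S n0"
    have g_eq: "g n = \<kappa> + real (Suc m) * S n" if "n \<ge> n0" for n
      using that
    proof (induction n rule: dec_induct)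
      case base
      show ?case by (simp add: \<kappa>_def)
    next
      case (step n)
      then show ?case using g_Suc[of n] by (simp add: S_Suc algebra_simps)
    qed
    have "(\<lambda>n. \<kappa> + real (Suc m) * S n) \<longlonglongrightarrow> \<kappa> + real (Suc m) * \<alpha>"
      by (intro tendsto_intros S_tendsto)
    moreover have "\<forall>\<^sub>F n in sequentially. \<kappa> + real (Suc m) * S n = g n"
      using g_eq by (intro eventually_sequentiallyI[of n0]) metis
    ultimately have "g \<longlonglongrightarrow> \<kappa> + real (Suc m) * \<alpha>" by (rule Lim_transform_eventually)
    then have "\<kappa> + real (Suc m) * \<alpha> \<in> \<rat>"
      using nz A unfolding g_def[abs_def] 
      by (intro uv_polys_quotient_limit_rational[of "A m" "A (Suc m)"]) auto
    moreover have "g n0 \<in> \<rat>"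
      unfolding g_def by (intro Rats_divide uv_polys_Rats A) auto
    then have "\<kappa> \<in> \<rat>"
      unfolding \<kappa>_def by (intro Rats_diff Rats_mult S_Rats) auto
    ultimately have "(\<kappa> + real (Suc m) * \<alpha> - \<kappa>) / real (Suc m) \<in> \<rat>"
      by (intro Rats_divide Rats_diff) auto
    then show False using \<alpha>_irrational by simp
  qed
  show ?case
  proof (cases "k = Suc m")
    case False
    then have "k \<le> m" using Suc.prems(3) by simp
    moreover have "\<forall>\<^sub>F n in sequentially. (\<Sum>k\<le>m. A k n * T n ^ k) = 0"
      using rel top by simp
    ultimately show ?thesis using A by (intro Suc.IH) auto
  qed (use top in simp)
qed

section \<open>Asymptotic expansions\<close>

definition uv_small :: "nat \<Rightarrow> (nat \<Rightarrow> real) set" where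
  "uv_small N = {s. \<exists>C. \<forall>n. \<bar>s n\<bar> \<le> C * u n ^ N}"

definition uv_approx :: "nat \<Rightarrow> (nat \<Rightarrow> real) set" where
  "uv_approx N = {s. \<exists>r\<in>uv_polys. (\<lambda>n. s n - r n) \<in> uv_small N}"

lemma uv_smallI: "(\<And>n. \<bar>s n\<bar> \<le> C * u n ^ N) \<Longrightarrow> s \<in> uv_small N"
  by (auto simp: uv_small_def)

lemma uv_smallE:
  assumes "s \<in> uv_small N"
  obtains C where "C \<ge> 0" "\<And>n. \<bar>s n\<bar> \<le> C * u n ^ N"
proof -
  obtain C where C: "\<And>n. \<bar>s n\<bar> \<le> C * u n ^ N" using assms by (auto simp: uv_small_def)
  have "0 \<le> C * u 0 ^ N" using C[of 0] by linarith
  moreover have "u 0 ^ N > 0" by simp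
  ultimately have "C \<ge> 0" by (metis zero_le_mult_iff not_le)
  then show thesis using C that by blast
qed

lemma uv_small_zero: "(\<lambda>_. 0) \<in> uv_small N"
  by (rule uv_smallI[of _ 0]) simp

lemma uv_small_add: "s \<in> uv_small N \<Longrightarrow> t \<in> uv_small N \<Longrightarrow> (\<lambda>n. s n + t n) \<in> uv_small N"
proof (elim uv_smallE)
  fix C D assume "\<And>n. \<bar>s n\<bar> \<le> C * u n ^ N" "\<And>n. \<bar>t n\<bar> \<le> D * u n ^ N"
  then show ?thesis 
    by (intro uv_smallI[of _ "C + D"]) (auto simp: distrib_right intro: order.trans[OF abs_triangle_ineq add_mono])
qed

lemma uv_small_mult: "s \<in> uv_small N \<Longrightarrow> t \<in> uv_small M \<Longrightarrow> (\<lambda>n. s n * t n) \<in> uv_small (N + M)"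
proof (elim uv_smallE)
  fix C D assume st: "0 \<le> C" "\<And>n. \<bar>s n\<bar> \<le> C * u n ^ N" "\<And>n. \<bar>t n\<bar> \<le> D * u n ^ M"
  have "\<bar>s n * t n\<bar> \<le> (C * u n ^ N) * (D * u n ^ M)" for n
    unfolding abs_mult using st by (intro mult_mono) auto
  then show ?thesis by (intro uv_smallI[of _ "C * D"]) (auto simp: power_add mult_ac)
qed

lemma uv_small_mono: "s \<in> uv_small N \<Longrightarrow> M \<le> N \<Longrightarrow> s \<in> uv_small M"
proof (elim uv_smallE)
  fix C assume "M \<le> N" and C: "0 \<le> C" "\<And>n. \<bar>s n\<bar> \<le> C * u n ^ N"
  have "C * u n ^ N \<le> C * u n ^ M" for n
    using C \<open>M \<le> N\<close> by (intro mult_left_mono power_decreasing) auto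
  then show ?thesis using C by (intro uv_smallI[of _ C]) (meson order.trans)
qed

lemma uv_small_sum: "(\<And>i. i \<in> I \<Longrightarrow> s i \<in> uv_small N) \<Longrightarrow> (\<lambda>n. \<Sum>i\<in>I. s i n) \<in> uv_small N"
proof (induction I rule: infinite_finite_induct)
  case (insert j I)
  then show ?case using uv_small_add[of "s j" N "\<lambda>n. \<Sum>i\<in>I. s i n"] by simp
qed (auto simp: uv_small_zero)

lemma uv_small_shift: "s \<in> uv_small N \<Longrightarrow> (\<lambda>n. s (Suc n)) \<in> uv_small N"
proof (elim uv_smallE)
  fix C assume C: "0 \<le> C" "\<And>n. \<bar>s n\<bar> \<le> C * u n ^ N"
  have "C * u (Suc n) ^ N \<le> C * u n ^ N" for n
    using C u_antimono[of n 1] by (intro mult_left_mono power_mono) auto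
  then show ?thesis using C(2) by (intro uv_smallI[of _ C]) (meson order.trans)
qed

lemma uv_small_const: "(\<lambda>_. c) \<in> uv_small 0"
  by (rule uv_smallI[of _ "\<bar>c\<bar>"]) simp

lemma u_uv_small: "u \<in> uv_small 1" and v_uv_small: "v \<in> uv_small 1"
  by (auto intro!: uv_smallI[of _ 1] v_le_u)

lemma uv_small_mult_left: "s \<in> uv_small 0 \<Longrightarrow> t \<in> uv_small N \<Longrightarrow> (\<lambda>n. s n * t n) \<in> uv_small N"
  using uv_small_mult[of s 0 t N] by simp

lemma uv_small_mult_right: "s \<in> uv_small N \<Longrightarrow> t \<in> uv_small 0 \<Longrightarrow> (\<lambda>n. s n * t n) \<in> uv_small N"
  using uv_small_mult[of s N t 0] by simp

lemma uv_small_power: "s \<in> uv_small N \<Longrightarrow> (\<lambda>n. s n ^ k) \<in> uv_small (k * N)"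
proof (induction k)
  case 0
  show ?case using uv_small_const[of 1] by simp
next
  case (Suc k)
  then show ?case using uv_small_mult[of s N "\<lambda>n. s n ^ k" "k * N"] by simp
qed

lemma uv_polys_bounded: "s \<in> uv_polys \<Longrightarrow> s \<in> uv_small 0"
proof (induction rule: uv_polys.induct)
  case (mult s t)
  then show ?case using uv_small_mult_left by blast
qed (auto intro: uv_small_const uv_small_add uv_small_mono[OF u_uv_small] uv_small_mono[OF v_uv_small])

section \<open>Expansions to finite order\<close>

lemma uv_approxI: "r \<in> uv_polys \<Longrightarrow> (\<lambda>n. s n - r n) \<in> uv_small N \<Longrightarrow> s \<in> uv_approx N"
  by (auto simp: uv_approx_def)

lemma uv_polys_approx: "s \<in> uv_polys \<Longrightarrow> s \<in> uv_approx N"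
  by (rule uv_approxI[of s]) (auto simp: uv_small_zero)

lemma uv_small_approx: "s \<in> uv_small N \<Longrightarrow> s \<in> uv_approx N"
  by (rule uv_approxI[of "\<lambda>_. 0"]) (use uv_polys_of_int[of 0] in auto)

lemma uv_approx_bounded:
  assumes "s \<in> uv_approx N"
  shows "s \<in> uv_small 0"
proof -
  obtain r where r: "r \<in> uv_polys" "(\<lambda>n. s n - r n) \<in> uv_small N"
    using assms by (auto simp: uv_approx_def)
  then have "(\<lambda>n. (s n - r n) + r n) \<in> uv_small 0"
    by (intro uv_small_add uv_polys_bounded uv_small_mono[OF r(2)]) auto
  then show ?thesis by simp
qed

lemma uv_approx_add:
  assumes "s \<in> uv_approx N" "t \<in> uv_approx N"
  shows "(\<lambda>n. s n + t n) \<in> uv_approx N"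
proof -
  obtain q r where "q \<in> uv_polys" "(\<lambda>n. s n - q n) \<in> uv_small N" "r \<in> uv_polys" "(\<lambda>n. t n - r n) \<in> uv_small N"
    using assms by (auto simp: uv_approx_def)
  then show ?thesis
    using uv_small_add[of "\<lambda>n. s n - q n" N "\<lambda>n. t n - r n"]
    by (intro uv_approxI[of "\<lambda>n. q n + r n"] uv_polys.add) (auto simp: algebra_simps)
qed

lemma uv_approx_mult:
  assumes "s \<in> uv_approx N" "t \<in> uv_approx N"
  shows "(\<lambda>n. s n * t n) \<in> uv_approx N"
proof -
  obtain q r where qr: "q \<in> uv_polys" "(\<lambda>n. s n - q n) \<in> uv_small N" "r \<in> uv_polys" "(\<lambda>n. t n - r n) \<in> uv_small N"
    using assms by (auto simp: uv_approx_def)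
  have "(\<lambda>n. (s n - q n) * t n + q n * (t n - r n)) \<in> uv_small N"
    using qr assms 
    by (intro uv_small_add uv_small_mult_left uv_small_mult_right uv_polys_bounded uv_approx_bounded[OF assms(2)]) auto
  then show ?thesis using qr
    by (intro uv_approxI[of "\<lambda>n. q n * r n"] uv_polys.mult) (auto simp: algebra_simps)
qed

lemma uv_approx_power: "s \<in> uv_approx N \<Longrightarrow> (\<lambda>n. s n ^ k) \<in> uv_approx N"
proof (induction k)
  case 0
  show ?case using uv_polys_approx[OF uv_polys_of_int[of 1]] by simp
next
  case (Suc k)
  then show ?case using uv_approx_mult[of s N "\<lambda>n. s n ^ k"] by simp
qed

text \<open>With \<open>w = u (n + 1)\<close> and \<open>G_rev w = c + w H w\<close>, the identity \<open>1 / G_rev w = (1 - w H w / G_rev w) / c\<close>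
  raises the order of an approximation by one.\<close>

lemma inverse_G_rev_approx: "(\<lambda>n. 1 / G_rev (u (Suc n))) \<in> uv_approx N"
proof (induction N)
  case 0
  have "\<bar>1 / G_rev (u (Suc n))\<bar> \<le> 1 * u n ^ 0" for n
    using G_rev_ge_1[of "u (Suc n)"] by simp
  then show ?case by (intro uv_small_approx uv_smallI)
next
  case (Suc N)
  define z where "z n = 1 / G_rev (u (Suc n))" for n
  define c where "c = coeff F d"
  define h where "h n = (\<Sum>i<d. of_int (coeff F i) * u (Suc n) ^ (d - Suc i))" for n
  have c: "c \<ge> 1" using lead_coeff_ge_1 by (simp add: c_def)
  have h: "h \<in> uv_polys" unfolding h_def by (intro uv_polys_intros u_Suc_uv_polys)
  have "G_rev (u (Suc n)) = of_int c + u (Suc n) * h n" for n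
  proof -
    have "G_rev (u (Suc n)) = of_int c + (\<Sum>i<d. of_int (coeff F i) * u (Suc n) ^ (d - i))"
      by (simp add: G_rev_def lessThan_Suc_atMost[symmetric] c_def)
    also have "(\<Sum>i<d. of_int (coeff F i) * u (Suc n) ^ (d - i)) = u (Suc n) * h n"
      unfolding h_def sum_distrib_left
    proof (intro sum.cong refl)
      fix i assume "i \<in> {..<d}"
      then have "d - i = Suc (d - Suc i)" by auto
      then show "of_int (coeff F i) * u (Suc n) ^ (d - i) = u (Suc n) * (of_int (coeff F i) * u (Suc n) ^ (d - Suc i))"
        by simp
    qed
    finally show ?thesis .
  qed
  moreover have "z n * G_rev (u (Suc n)) = 1" for n using G_rev_ge_1[of "u (Suc n)"] by (simp add: z_def)
  ultimately have "z n * (of_int c + u (Suc n) * h n) = 1" for n by simp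
  then have "z n * of_int c = 1 - u (Suc n) * h n * z n" for n
    by (simp add: algebra_simps)
  then have z: "z n = (1 - u (Suc n) * h n * z n) / of_int c" for n
    using c by (simp add: eq_divide_eq)
  obtain r where r: "r \<in> uv_polys" "(\<lambda>n. z n - r n) \<in> uv_small N"
    using Suc by (auto simp: uv_approx_def z_def)
  have "(\<lambda>n. u n * (z n - r n)) \<in> uv_small (Suc N)"
    using uv_small_mult[OF u_uv_small r(2)] by simp
  from uv_small_mult_left[OF uv_polys_bounded[OF uv_polys.v] this]
  have "(\<lambda>n. v n * (u n * (z n - r n))) \<in> uv_small (Suc N)" .
  from uv_small_mult_left[OF uv_polys_bounded[OF h] this]
  have "(\<lambda>n. h n * (v n * (u n * (z n - r n)))) \<in> uv_small (Suc N)" .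
  from uv_small_mult_left[OF uv_small_const this]
  have "(\<lambda>n. (- 1 / of_int c) * (h n * (v n * (u n * (z n - r n))))) \<in> uv_small (Suc N)" .
  moreover have "(- 1 / of_int c) * (h n * (v n * (u n * (z n - r n)))) =
      (1 - u (Suc n) * h n * z n) / of_int c - of_rat (1 / of_int c) * (1 - u (Suc n) * h n * r n)" for n
    using c by (simp add: u_Suc of_rat_divide field_simps)
  ultimately have "(\<lambda>n. z n - of_rat (1 / of_int c) * (1 - u (Suc n) * h n * r n)) \<in> uv_small (Suc N)"
    by (simp only: z[symmetric])
  moreover have "(\<lambda>n. of_rat (1 / of_int c) * (1 - u (Suc n) * h n * r n)) \<in> uv_polys"
    using uv_polys_of_int[of 1] h r u_Suc_uv_polys
    by (intro uv_polys.mult uv_polys.const uv_polys_diff) auto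
  ultimately show ?case unfolding z_def[symmetric] by (rule uv_approxI[rotated])
qed

lemma uv_polys_shift_approx: "s \<in> uv_polys \<Longrightarrow> (\<lambda>n. s (Suc n)) \<in> uv_approx N"
proof (induction rule: uv_polys.induct)
  case v
  show ?case unfolding v_Suc
    by (intro uv_approx_mult inverse_G_rev_approx uv_polys_approx uv_polys_intros u_Suc_uv_polys)
qed (auto intro: uv_polys_approx uv_polys.const u_Suc_uv_polys uv_approx_add uv_approx_mult)

lemma uv_approx_shift:
  assumes "s \<in> uv_approx N"
  shows "(\<lambda>n. s (Suc n)) \<in> uv_approx N"
proof -
  obtain r where r: "r \<in> uv_polys" "(\<lambda>n. s n - r n) \<in> uv_small N"
    using assms by (auto simp: uv_approx_def)
  have "(\<lambda>n. (s (Suc n) - r (Suc n)) + r (Suc n)) \<in> uv_approx N"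
    using uv_small_shift[OF r(2)] r by (intro uv_approx_add uv_small_approx uv_polys_shift_approx)
  then show ?thesis by simp
qed

lemma u_shift_approx: "(\<lambda>n. u (n + j)) \<in> uv_approx N"
proof (induction j)
  case 0
  show ?case by (simp add: uv_polys_approx uv_polys.u)
next
  case (Suc j)
  then show ?case using uv_approx_shift[of "\<lambda>n. u (n + j)"] by simp
qed

text \<open>After \<open>N\<close> summands the remaining tail is already \<open>O(u ^ N)\<close> by
  \<open>u_power\<close>, and each split-off summand is a shift of \<open>u\<close> and has its own
  expansion.\<close>

lemma T_approx: "T \<in> uv_approx N"
proof -
  have T: "T n = (\<Sum>j<k. u (n + Suc j)) + T (n + k)" for n k
    by (induction k) (auto simp: T_Suc)
  have "\<bar>T (n + N)\<bar> \<le> 2 * u n ^ N" for n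
  proof -
    have "\<bar>T (n + N)\<bar> \<le> 2 * u (n + Suc N)" using T_pos[of "n + N"] T_le[of "n + N"] by simp
    also have "u (n + Suc N) \<le> u n ^ Suc (Suc N)" by (rule u_power)
    also have "\<dots> \<le> u n ^ N" by (intro power_decreasing) auto
    finally show ?thesis by simp
  qed
  then have "(\<lambda>n. T (n + N)) \<in> uv_approx N" by (intro uv_small_approx uv_smallI)
  moreover have "(\<lambda>n. \<Sum>j<k. u (n + Suc j)) \<in> uv_approx N" for k
  proof (induction k)
    case 0
    show ?case using uv_polys_approx[OF uv_polys_of_int[of 0]] by simp
  next
    case (Suc k)
    then show ?case using uv_approx_add[OF _ u_shift_approx[of "Suc k"]] by simp
  qed
  ultimately have "(\<lambda>n. (\<Sum>j<N. u (n + Suc j)) + T (n + N)) \<in> uv_approx N"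
    by (intro uv_approx_add)
  moreover have "(\<lambda>n. (\<Sum>j<N. u (n + Suc j)) + T (n + N)) = T"
    by (rule ext) (rule T[symmetric])
  ultimately show ?thesis by simp
qed

text \<open>As \<open>v\<close> is at most \<open>u\<close>, a monomial is at least as small as
  \<open>u\<close> to its total degree, and one exponent reaching \<open>N\<close> suffices.\<close>

lemma uv_monom_small:
  assumes "p \<notin> {..<N} \<times> {..<N}"
  shows "uv_monom p \<in> uv_small N"
proof -
  have "(\<lambda>n. u n ^ fst p * v n ^ snd p) \<in> uv_small (fst p * 1 + snd p * 1)"
    by (intro uv_small_mult uv_small_power u_uv_small v_uv_small)
  moreover have "N \<le> fst p * 1 + snd p * 1" using assms by (cases p) auto
  ultimately show ?thesis unfolding uv_monom_def[abs_def] by (rule uv_small_mono)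
qed

text \<open>Monomials outside the square go into the error term, so \<open>N * N\<close>
  coefficients remain. This count is what the number of unknowns has to exceed.\<close>

lemma uv_approx_expansion:
  assumes "s \<in> uv_approx N"
  shows "\<exists>c. (\<lambda>n. s n - (\<Sum>p\<in>{..<N} \<times> {..<N}. of_rat (c p) * uv_monom p n)) \<in> uv_small N"
proof -
  obtain r where r: "r \<in> uv_polys" "(\<lambda>n. s n - r n) \<in> uv_small N"
    using assms by (auto simp: uv_approx_def)
  obtain I c where I: "finite I" "r = (\<lambda>n. \<Sum>p\<in>I. of_rat (c p) * uv_monom p n)"
    using uv_polys_rep[OF r(1)] by blast
  define c' where "c' p = (if p \<in> I then c p else 0)" for p
  let ?Q = "{..<N} \<times> {..<N}"
  have "(\<lambda>n. \<Sum>p\<in>I - ?Q. of_rat (c p) * uv_monom p n) \<in> uv_small N"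
    by (intro uv_small_sum uv_small_mult_left uv_small_const uv_monom_small) auto
  then have "(\<lambda>n. (s n - r n) + (\<Sum>p\<in>I - ?Q. of_rat (c p) * uv_monom p n)) \<in> uv_small N"
    using r by (intro uv_small_add)
  moreover have "(s n - r n) + (\<Sum>p\<in>I - ?Q. of_rat (c p) * uv_monom p n) = s n - (\<Sum>p\<in>?Q. of_rat (c' p) * uv_monom p n)" for n
  proof -
    have "r n = (\<Sum>p\<in>I - ?Q. of_rat (c p) * uv_monom p n) + (\<Sum>p\<in>I \<inter> ?Q. of_rat (c p) * uv_monom p n)"
      unfolding I(2) using I(1) by (subst sum.union_disjoint[symmetric]) (auto intro: sum.cong)
    also have "(\<Sum>p\<in>I \<inter> ?Q. of_rat (c p) * uv_monom p n) = (\<Sum>p\<in>?Q. of_rat (c' p) * uv_monom p n)"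
      by (intro sum.mono_neutral_cong_left) (auto simp: c'_def)
    finally show ?thesis by simp
  qed
  ultimately show ?thesis by auto
qed

section \<open>The auxiliary polynomial\<close>

text \<open>There are \<open>p * p * p\<close> unknown coefficients, and the vanishing of the
  expansion up to order \<open>N\<close> imposes only \<open>N * N\<close> rational linear
  conditions.\<close>

lemma small_auxiliary_polynomial:
  assumes "N * N < p * p * p"
  obtains a :: "nat \<times> nat \<times> nat \<Rightarrow> int" where
    "\<exists>z\<in>{..<p} \<times> {..<p} \<times> {..<p}. a z \<noteq> 0"
    "(\<lambda>n. \<Sum>(i, j, k)\<in>{..<p} \<times> {..<p} \<times> {..<p}. of_int (a (i, j, k)) * (u n ^ i * v n ^ j * T n ^ k)) \<in> uv_small N"
proof -
  let ?Z = "{..<p} \<times> {..<p} \<times> {..<p}" and ?Q = "{..<N} \<times> {..<N}"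
  define s where "s z n = (case z of (i, j, k) \<Rightarrow> u n ^ i * v n ^ j * T n ^ k)" for z n
  have "(\<lambda>n. u n ^ i * v n ^ j * T n ^ k) \<in> uv_approx N" for i j k
    by (rule uv_approx_mult[OF uv_approx_mult[OF uv_approx_power[OF uv_polys_approx[OF uv_polys.u]]
          uv_approx_power[OF uv_polys_approx[OF uv_polys.v]]] uv_approx_power[OF T_approx]])
  then have "s z \<in> uv_approx N" for z
    unfolding s_def[abs_def] by (cases z) simp
  then have "\<forall>z. \<exists>c. (\<lambda>n. s z n - (\<Sum>q\<in>?Q. of_rat (c q) * uv_monom q n)) \<in> uv_small N"
    using uv_approx_expansion by blast
  from choice[OF this] obtain c where c: "\<And>z. (\<lambda>n. s z n - (\<Sum>q\<in>?Q. of_rat (c z q) * uv_monom q n)) \<in> uv_small N"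
    by blast
  have "card ?Q < card ?Z" using assms by (simp add: card_cartesian_product mult_ac)
  then have "\<exists>a::nat \<times> nat \<times> nat \<Rightarrow> int. (\<exists>z\<in>?Z. a z \<noteq> 0) \<and> (\<forall>q\<in>?Q. (\<Sum>z\<in>?Z. of_int (a z) * c z q) = 0)"
    by (intro homogeneous_system_solution_int finite_cartesian_product finite_lessThan)
  then obtain a :: "nat \<times> nat \<times> nat \<Rightarrow> int" where a: "\<exists>z\<in>?Z. a z \<noteq> 0" 
    "\<forall>q\<in>?Q. (\<Sum>z\<in>?Z. of_int (a z) * c z q) = 0"
    by (elim exE conjE)
  \<comment> \<open>The linear conditions make the combined expansions vanish, so subtracting them
    changes nothing and only error terms are left.\<close>
  have "(\<Sum>z\<in>?Z. of_int (a z) * s z n) = 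
      (\<Sum>z\<in>?Z. of_int (a z) * (s z n - (\<Sum>q\<in>?Q. of_rat (c z q) * uv_monom q n)))" for n
  proof -
    have "(\<Sum>z\<in>?Z. of_int (a z) * (\<Sum>q\<in>?Q. of_rat (c z q) * uv_monom q n)) 
        = (\<Sum>q\<in>?Q. of_rat (\<Sum>z\<in>?Z. of_int (a z) * c z q) * uv_monom q n)"
      unfolding of_rat_sum of_rat_mult of_rat_of_int_eq sum_distrib_left sum_distrib_right
      by (subst sum.swap) (simp only: mult_ac)
    also have "\<dots> = 0" using a(2) by (intro sum.neutral) auto
    finally show ?thesis by (simp add: right_diff_distrib sum_subtractf)
  qed
  moreover have "(\<lambda>n. \<Sum>z\<in>?Z. of_int (a z) * (s z n - (\<Sum>q\<in>?Q. of_rat (c z q) * uv_monom q n))) \<in> uv_small N"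
    by (intro uv_small_sum uv_small_mult_left[OF uv_small_const] c)
  ultimately have "(\<lambda>n. \<Sum>z\<in>?Z. of_int (a z) * s z n) \<in> uv_small N" by simp
  then have "(\<lambda>n. \<Sum>(i, j, k)\<in>?Z. of_int (a (i, j, k)) * (u n ^ i * v n ^ j * T n ^ k)) \<in> uv_small N"
    by (simp add: s_def case_prod_unfold)
  then show thesis using a(1) that by blast
qed

text \<open>Sorted by powers of \<open>T\<close>, eventual vanishing kills each coefficient in
  \<open>u\<close> and \<open>v\<close>; independence of the monomials then kills each integer
  \<open>a z\<close>.\<close>

lemma auxiliary_polynomial_frequently_nonzero:
  fixes a :: "nat \<times> nat \<times> nat \<Rightarrow> int"
  assumes "\<exists>z\<in>{..<p} \<times> {..<p} \<times> {..<p}. a z \<noteq> 0"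
  shows "\<exists>\<^sub>F n in sequentially. 
    (\<Sum>(i, j, k)\<in>{..<p} \<times> {..<p} \<times> {..<p}. of_int (a (i, j, k)) * (u n ^ i * v n ^ j * T n ^ k)) \<noteq> 0"
proof -
  obtain i0 j0 k0 where z: "i0 < p" "j0 < p" "k0 < p" "a (i0, j0, k0) \<noteq> 0" using assms by auto
  define A where "A k n = (\<Sum>q\<in>{..<p} \<times> {..<p}. of_rat (of_int (a (fst q, snd q, k))) * uv_monom q n)" for k n
  have A: "A k \<in> uv_polys" for k
    unfolding A_def uv_monom_def by (intro uv_polys_intros)
  have eq: "(\<Sum>(i, j, k)\<in>{..<p} \<times> {..<p} \<times> {..<p}. of_int (a (i, j, k)) * (u n ^ i * v n ^ j * T n ^ k)) 
      = (\<Sum>k\<le>p - 1. A k n * T n ^ k)" for n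
  proof -
    have "(\<Sum>(i, j, k)\<in>{..<p} \<times> {..<p} \<times> {..<p}. of_int (a (i, j, k)) * (u n ^ i * v n ^ j * T n ^ k))
      = (\<Sum>i<p. \<Sum>j<p. \<Sum>k<p. of_int (a (i, j, k)) * (u n ^ i * v n ^ j * T n ^ k))"
      by (simp add: sum.cartesian_product[symmetric])
    also have "\<dots> = (\<Sum>i<p. \<Sum>k<p. \<Sum>j<p. of_int (a (i, j, k)) * (u n ^ i * v n ^ j * T n ^ k))"
      by (intro sum.cong refl sum.swap)
    also have "\<dots> = (\<Sum>k<p. \<Sum>i<p. \<Sum>j<p. of_int (a (i, j, k)) * (u n ^ i * v n ^ j * T n ^ k))"
      by (rule sum.swap)
    also have "\<dots> = (\<Sum>k<p. A k n * T n ^ k)"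
    proof (intro sum.cong refl)
      fix k
      show "(\<Sum>i<p. \<Sum>j<p. of_int (a (i, j, k)) * (u n ^ i * v n ^ j * T n ^ k)) = A k n * T n ^ k"
        unfolding A_def sum_distrib_right sum.cartesian_product
        by (intro sum.cong refl) (simp add: uv_monom_def case_prod_unfold mult_ac)
    qed
    also have "\<dots> = (\<Sum>k\<le>p - 1. A k n * T n ^ k)" using z by (intro sum.cong) auto
    finally show ?thesis .
  qed
  show ?thesis
    unfolding frequently_def not_not
  proof
    assume "\<forall>\<^sub>F n in sequentially. (\<Sum>(i, j, k)\<in>{..<p} \<times> {..<p} \<times> {..<p}. of_int (a (i, j, k)) * (u n ^ i * v n ^ j * T n ^ k)) = 0"
    then have "\<forall>\<^sub>F n in sequentially. (\<Sum>k\<le>p - 1. A k n * T n ^ k) = 0" unfolding eq .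
    moreover have "k0 \<le> p - 1" using z by simp
    ultimately have "A k0 = (\<lambda>_. 0)"
      using A by (intro T_transcendental_over_uv_polys[of "p - 1" A k0])
    then have "A k0 n = 0" for n by simp
    then have "rat_of_int (a (fst (i0, j0), snd (i0, j0), k0)) = 0"
      using z unfolding A_def
      by (intro uv_monoms_independent[of "{..<p} \<times> {..<p}" "\<lambda>q. of_int (a (fst q, snd q, k0))" "(i0, j0)"]) auto
    then show False using z by simp
  qed
qed

section \<open>Denominators and the final comparison\<close>

lemma S_nonneg: "S n \<ge> 0" and S_le: "S n \<le> \<alpha>"
proof -
  show "S n \<ge> 0" unfolding S_def by (intro sum_nonneg) auto
  show "S n \<le> \<alpha>" using T_pos[of n] by (simp add: T_def)
qed

text \<open>Expanding \<open>T n = \<alpha> - S n\<close> gives a polynomial in \<alpha>. Powers of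
  \<open>u n\<close>, \<open>v n\<close> and \<open>S n\<close> are cleared by \<open>x n\<close>,
  \<open>x (Suc n) / x n\<close> and \<open>x n\<close> to the power \<open>p\<close>, and these
  three factors multiply to \<open>(x n * x (Suc n)) ^ p\<close>.\<close>

lemma auxiliary_polynomial_in_\<alpha>:
  fixes a :: "nat \<times> nat \<times> nat \<Rightarrow> int"
  obtains C where "C \<ge> 1" "\<And>n. \<exists>b::nat \<Rightarrow> int. (\<forall>l<p. \<bar>of_int (b l)\<bar> \<le> C * (x n * x (Suc n)) ^ p) \<and>
    (\<Sum>l<p. of_int (b l) * \<alpha> ^ l) = (x n * x (Suc n)) ^ p *
      (\<Sum>(i, j, k)\<in>{..<p} \<times> {..<p} \<times> {..<p}. of_int (a (i, j, k)) * (u n ^ i * v n ^ j * T n ^ k))"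
proof -
  let ?Z = "{..<p} \<times> {..<p} \<times> {..<p}"
  have \<alpha>: "\<alpha> \<ge> 0" using S_nonneg S_le order.trans by blast
  \<comment> \<open>Independent of \<open>n\<close>, because \<open>S n\<close> lies between 0 and
    \<alpha> while \<open>u n\<close> and \<open>v n\<close> are at most 1.\<close>
  define C where "C = 1 + (\<Sum>l<p. \<Sum>(i, j, k)\<in>?Z. \<bar>real_of_int (a (i, j, k))\<bar> * (real (k choose l) * \<alpha> ^ (k - l)))"
  have C_ge: "(\<Sum>(i, j, k)\<in>?Z. \<bar>real_of_int (a (i, j, k))\<bar> * (real (k choose l) * \<alpha> ^ (k - l))) \<le> C" if "l < p" for l
  proof -
    have "(\<Sum>(i, j, k)\<in>?Z. \<bar>real_of_int (a (i, j, k))\<bar> * (real (k choose l) * \<alpha> ^ (k - l)))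
      \<le> (\<Sum>l<p. \<Sum>(i, j, k)\<in>?Z. \<bar>real_of_int (a (i, j, k))\<bar> * (real (k choose l) * \<alpha> ^ (k - l)))"
      using that \<alpha> 
      by (intro member_le_sum[where f = "\<lambda>l. \<Sum>(i, j, k)\<in>?Z. \<bar>real_of_int (a (i, j, k))\<bar> * (real (k choose l) * \<alpha> ^ (k - l))"])
         (auto intro!: sum_nonneg)
    then show ?thesis by (simp add: C_def)
  qed
  have "C \<ge> 1" unfolding C_def using \<alpha> by (auto intro!: sum_nonneg)
  moreover have "\<exists>b::nat \<Rightarrow> int. (\<forall>l<p. \<bar>of_int (b l)\<bar> \<le> C * (x n * x (Suc n)) ^ p) \<and>
    (\<Sum>l<p. of_int (b l) * \<alpha> ^ l) = (x n * x (Suc n)) ^ p *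
      (\<Sum>(i, j, k)\<in>?Z. of_int (a (i, j, k)) * (u n ^ i * v n ^ j * T n ^ k))" for n
  proof -
    define X where "X = x n * x (Suc n)"
    define \<beta> where "\<beta> l = (\<Sum>(i, j, k)\<in>?Z. of_int (a (i, j, k)) * 
      (u n ^ i * v n ^ j * (real (k choose l) * (- S n) ^ (k - l))))" for l
    have X: "X \<ge> 0" by (simp add: X_def less_imp_le)
    have "X ^ p * \<beta> l \<in> \<int>" for l
      unfolding \<beta>_def sum_distrib_left
    proof (rule Ints_sum, clarify)
      fix i j k assume ijk: "i < p" "j < p" "k < p"
      define w where "w = x (Suc n) / x n"
      have w: "w \<in> \<int>" using x_ratio_Ints by (simp add: w_def)
      have "x n ^ p * u n ^ i = x n ^ (p - i)"
        using ijk by (simp add: u_def power_one_over power_diff field_simps)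
      then have 1: "x n ^ p * u n ^ i \<in> \<int>" using x_Ints by simp
      have "w ^ p * v n ^ j = w ^ (p - j)"
      proof -
        have "w * v n = 1" by (simp add: w_def v_def)
        have "w ^ p = w ^ (p - j) * w ^ j" using ijk by (simp flip: power_add)
        then show ?thesis using \<open>w * v n = 1\<close> by (simp add: mult.assoc flip: power_mult_distrib)
      qed
      then have 2: "w ^ p * v n ^ j \<in> \<int>" using w by simp
      have "x n ^ p * (- S n) ^ (k - l) = x n ^ (p - (k - l)) * (- (S n * x n)) ^ (k - l)"
      proof -
        have "x n ^ p = x n ^ (p - (k - l)) * x n ^ (k - l)" using ijk by (simp flip: power_add)
        then show ?thesis by (simp add: mult_ac flip: power_mult_distrib)
      qed
      then have 3: "x n ^ p * (- S n) ^ (k - l) \<in> \<int>" using x_Ints S_x_Ints by simp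
      have "X = x n * w * x n" by (simp add: X_def w_def)
      then have "X ^ p * (of_int (a (i, j, k)) * (u n ^ i * v n ^ j * (real (k choose l) * (- S n) ^ (k - l))))
        = of_int (a (i, j, k)) * real (k choose l) * (x n ^ p * u n ^ i) * (w ^ p * v n ^ j) * (x n ^ p * (- S n) ^ (k - l))"
        by (simp only: power_mult_distrib mult_ac)
      also have "\<dots> \<in> \<int>" by (rule Ints_mult[OF Ints_mult[OF Ints_mult[OF _ 1] 2] 3]) simp
      finally show "X ^ p * (of_int (a (i, j, k)) * (u n ^ i * v n ^ j * (real (k choose l) * (- S n) ^ (k - l)))) \<in> \<int>" .
    qed
    then have "\<forall>l. \<exists>b::int. X ^ p * \<beta> l = of_int b" by (metis Ints_cases)
    then obtain b :: "nat \<Rightarrow> int" where b: "\<And>l. X ^ p * \<beta> l = of_int (b l)" by metis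
    have "\<bar>of_int (b l)\<bar> \<le> C * X ^ p" if "l < p" for l
    proof -
      have "\<bar>\<beta> l\<bar> \<le> (\<Sum>(i, j, k)\<in>?Z. \<bar>real_of_int (a (i, j, k))\<bar> * (real (k choose l) * \<alpha> ^ (k - l)))"
        unfolding \<beta>_def
      proof (rule order.trans[OF sum_abs sum_mono], clarify)
        fix i j k
        have "u n ^ i * v n ^ j * (real (k choose l) * S n ^ (k - l)) \<le> 1 * 1 * (real (k choose l) * \<alpha> ^ (k - l))"
          using S_nonneg[of n] S_le[of n]
          by (intro mult_mono power_mono power_le_one mult_nonneg_nonneg) auto
        then show "\<bar>of_int (a (i, j, k)) * (u n ^ i * v n ^ j * (real (k choose l) * (- S n) ^ (k - l)))\<bar> 
          \<le> \<bar>real_of_int (a (i, j, k))\<bar> * (real (k choose l) * \<alpha> ^ (k - l))"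
          using S_nonneg[of n] by (simp add: abs_mult power_abs mult_left_mono)
      qed
      also have "\<dots> \<le> C" by (rule C_ge[OF that])
      finally have "\<bar>\<beta> l\<bar> * X ^ p \<le> C * X ^ p" using X by (intro mult_right_mono) auto
      then show ?thesis using X by (simp add: abs_mult mult.commute flip: b)
    qed
    moreover have "(\<Sum>l<p. of_int (b l) * \<alpha> ^ l) = X ^ p *
      (\<Sum>(i, j, k)\<in>?Z. of_int (a (i, j, k)) * (u n ^ i * v n ^ j * T n ^ k))"
    proof -
      have T: "T n ^ k = (\<Sum>l<p. real (k choose l) * (- S n) ^ (k - l) * \<alpha> ^ l)" if "k < p" for k
      proof -
        have "T n ^ k = (\<alpha> + - S n) ^ k" by (simp add: T_def)
        also have "\<dots> = (\<Sum>l\<le>k. real (k choose l) * \<alpha> ^ l * (- S n) ^ (k - l))"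
          by (rule binomial_ring)
        also have "\<dots> = (\<Sum>l<p. real (k choose l) * \<alpha> ^ l * (- S n) ^ (k - l))"
          using that by (intro sum.mono_neutral_left) (auto simp: binomial_eq_0)
        finally show ?thesis by (simp only: mult_ac)
      qed
      have "(\<Sum>l<p. of_int (b l) * \<alpha> ^ l) = X ^ p * (\<Sum>l<p. \<beta> l * \<alpha> ^ l)"
        by (simp add: sum_distrib_left mult.assoc flip: b)
      also have "(\<Sum>l<p. \<beta> l * \<alpha> ^ l) = (\<Sum>(i, j, k)\<in>?Z. of_int (a (i, j, k)) * (u n ^ i * v n ^ j * 
          (\<Sum>l<p. real (k choose l) * (- S n) ^ (k - l) * \<alpha> ^ l)))"
        unfolding \<beta>_def sum_distrib_right sum_distrib_left case_prod_unfold
        by (subst sum.swap) (simp only: mult_ac)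
      also have "\<dots> = (\<Sum>(i, j, k)\<in>?Z. of_int (a (i, j, k)) * (u n ^ i * v n ^ j * T n ^ k))"
        by (intro sum.cong) (auto simp: T)
      finally show ?thesis .
    qed
    ultimately show ?thesis unfolding X_def[symmetric] by blast
  qed
  ultimately show thesis using that by blast
qed

lemma \<alpha>_transcendental: "\<not> algebraic \<alpha>"
proof
  assume "algebraic \<alpha>"
  from algebraic_polynomial_value_lower_bound[OF this] obtain D where D: "\<forall>p. \<exists>c>0. \<forall>H\<ge>1. \<forall>b::nat \<Rightarrow> int. (\<forall>i<p. \<bar>of_int (b i)\<bar> \<le> H) \<longrightarrow>
    (\<Sum>i<p. of_int (b i) * \<alpha> ^ i) \<noteq> 0 \<longrightarrow> c \<le> \<bar>\<Sum>i<p. of_int (b i) * \<alpha> ^ i\<bar> * H ^ D"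
    by blast
  \<comment> \<open>The product \<open>x n * x (Suc n)\<close> is at most a constant times
    \<open>x n ^ (d + 3)\<close>. It enters with exponent \<open>p\<close> from the denominator and
    \<open>p * D\<close> from the height, so the total loss is a constant times
    \<open>x n ^ (p * K)\<close>.\<close>
  define K where "K = (d + 3) * Suc D"
  \<comment> \<open>With \<open>p = q ^ 2\<close> and \<open>N = q ^ 3 - 1\<close> one has
    \<open>N * N < q ^ 6 = p ^ 3\<close>, where the subtracted 1 gives strictness;
    \<open>q = K + 2\<close> yields \<open>q ^ 3 = p * K + 2 * p\<close>, so \<open>N\<close> still
    exceeds \<open>p * K\<close>.\<close>
  define q where "q = K + 2"
  define p where "p = q ^ 2"
  define N where "N = q ^ 3 - 1"
  have "q \<ge> 2" by (simp add: q_def)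
  have "N < q ^ 3" using \<open>q \<ge> 2\<close> by (simp add: N_def)
  then have "N * N < q ^ 3 * q ^ 3" using \<open>q \<ge> 2\<close> by (intro mult_strict_mono) auto
  then have "N * N < p * p * p" by (simp add: p_def flip: power_add)
  then obtain a :: "nat \<times> nat \<times> nat \<Rightarrow> int" where
    a: "\<exists>z\<in>{..<p} \<times> {..<p} \<times> {..<p}. a z \<noteq> 0"
    "(\<lambda>n. \<Sum>(i, j, k)\<in>{..<p} \<times> {..<p} \<times> {..<p}. of_int (a (i, j, k)) * (u n ^ i * v n ^ j * T n ^ k)) \<in> uv_small N"
    by (rule small_auxiliary_polynomial)
  define E where "E n = (\<Sum>(i, j, k)\<in>{..<p} \<times> {..<p} \<times> {..<p}. of_int (a (i, j, k)) * (u n ^ i * v n ^ j * T n ^ k))" for n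
  obtain C1 where C1: "C1 \<ge> 0" "\<And>n. \<bar>E n\<bar> \<le> C1 * u n ^ N"
    using uv_smallE[OF a(2)[folded E_def]] by blast
  obtain C2 where C2: "C2 \<ge> 1" "\<And>n. \<exists>b::nat \<Rightarrow> int. (\<forall>l<p. \<bar>of_int (b l)\<bar> \<le> C2 * (x n * x (Suc n)) ^ p) \<and>
    (\<Sum>l<p. of_int (b l) * \<alpha> ^ l) = (x n * x (Suc n)) ^ p * E n"
    using auxiliary_polynomial_in_\<alpha>[of p a] unfolding E_def by blast
  obtain c where c: "c > 0" "\<forall>H\<ge>1. \<forall>b::nat \<Rightarrow> int. (\<forall>i<p. \<bar>of_int (b i)\<bar> \<le> H) \<longrightarrow>
    (\<Sum>i<p. of_int (b i) * \<alpha> ^ i) \<noteq> 0 \<longrightarrow> c \<le> \<bar>\<Sum>i<p. of_int (b i) * \<alpha> ^ i\<bar> * H ^ D"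
    using D by blast
  define C3 where "C3 = C1 * C2 ^ D * G 1 ^ (p * Suc D)"
  have N: "p * K + 1 \<le> N"
  proof -
    have "q ^ 3 = p * K + p * 2" by (simp add: p_def q_def power3_eq_cube power2_eq_square algebra_simps)
    moreover have "p \<ge> 1" using \<open>q \<ge> 2\<close> by (simp add: p_def)
    ultimately show ?thesis unfolding N_def by linarith
  qed
  \<comment> \<open>The lower bound for nonzero values meets the upper bound
    \<open>O(u ^ N)\<close>; the surplus of \<open>N\<close> over \<open>p * K\<close> leaves a
    factor \<open>u n\<close>. Since it tends to 0, \<open>E n\<close> must vanish
    eventually.\<close>
  have main: "c \<le> C3 * u n" if "E n \<noteq> 0" for n
  proof -
    define X where "X = x n * x (Suc n)"
    have X: "X \<ge> 1" unfolding X_def using x_ge_1[of n] x_ge_1[of "Suc n"] mult_mono[of 1 "x n" 1 "x (Suc n)"] by simp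
    obtain b :: "nat \<Rightarrow> int" where b: "\<forall>l<p. \<bar>of_int (b l)\<bar> \<le> C2 * X ^ p" "(\<Sum>l<p. of_int (b l) * \<alpha> ^ l) = X ^ p * E n"
      using C2(2)[of n] unfolding X_def by blast
    have "1 * 1 \<le> C2 * X ^ p" using C2 X by (intro mult_mono one_le_power) auto
    moreover have "X ^ p * E n \<noteq> 0" using X that by simp
    ultimately have "c \<le> \<bar>X ^ p * E n\<bar> * (C2 * X ^ p) ^ D"
      using c(2)[rule_format, of "C2 * X ^ p" b] b by simp
    also have "\<dots> = \<bar>E n\<bar> * C2 ^ D * X ^ (p * Suc D)"
      using X by (simp add: abs_mult power_mult_distrib power_add power_mult)
    also have "\<dots> \<le> (C1 * u n ^ N) * C2 ^ D * (G 1 * x n ^ (d + 3)) ^ (p * Suc D)"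
    proof -
      have "X \<le> x n * (G 1 * x n ^ (d + 2))"
        unfolding X_def using x_Suc_le[of n] by (intro mult_left_mono) (auto simp: less_imp_le)
      also have "\<dots> = G 1 * x n ^ (d + 3)" by (simp add: numeral_3_eq_3 numeral_2_eq_2)
      finally have "X ^ (p * Suc D) \<le> (G 1 * x n ^ (d + 3)) ^ (p * Suc D)" using X by (intro power_mono) auto
      then show ?thesis using C1 C2 X by (intro mult_mono) auto
    qed
    also have "\<dots> = C3 * (u n ^ N * x n ^ (p * K))"
      by (simp only: C3_def K_def power_mult_distrib power_mult[symmetric] mult_ac)
    also have "\<dots> \<le> C3 * u n"
    proof (rule mult_left_mono)
      have "u n ^ N * x n ^ (p * K) \<le> u n ^ (p * K + 1) * x n ^ (p * K)"
        using N by (intro mult_right_mono power_decreasing) (auto simp: less_imp_le)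
      also have "\<dots> = u n" by (simp add: u_def power_one_over)
      finally show "u n ^ N * x n ^ (p * K) \<le> u n" .
      show "C3 \<ge> 0" using C1 C2 G_ge[of 1] by (simp add: C3_def)
    qed
    finally show ?thesis .
  qed
  have "(\<lambda>n. C3 * u n) \<longlonglongrightarrow> C3 * 0" by (intro tendsto_intros u_tendsto_0)
  then have "\<forall>\<^sub>F n in sequentially. C3 * u n < c" using c by (intro order_tendstoD) auto
  then have "\<forall>\<^sub>F n in sequentially. E n = 0"
    by eventually_elim (use main in force)
  moreover have "\<exists>\<^sub>F n in sequentially. E n \<noteq> 0"
    unfolding E_def by (rule auxiliary_polynomial_frequently_nonzero[OF a(1)])
  ultimately show False by (simp add: frequently_def)
qed

end

theorem theorem3p1:
  fixes F :: "int poly" and x :: "nat \<Rightarrow> real"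
  assumes F_nonneg: "\<And>i. coeff F i \<ge> 0"
    and F_degree: "degree F \<ge> 1"
    and F_at_0: "poly F 0 = 1"
    and x_0: "x 0 = 1"
    and x_1: "x 1 = 1"
    and x_rec: "\<And>n. x (n + 2) * x n = (x (n + 1))\<^sup>2 * poly (map_poly real_of_int F) (x (n + 1))"
  shows "summable (\<lambda>j. 1 / x (j + 1)) \<and> \<not> algebraic (\<Sum>j. 1 / x (j + 1))"
proof -
  interpret hone_sequence F x
    using assms by unfold_locales auto
  show ?thesis
    using summable_inverse_x \<alpha>_transcendental unfolding \<alpha>_def by blast
qed

end
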